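(* Suppose that, for each $n\ge1$, $X^{(n)}\in\mathcal{S}^M_{\mathfrak{r}_n}$ is an ergodic chain with transition kernel $P_n$, and let $(\theta_{n,i})_{i=1}^{\mathfrak{r}_n}$ be the non-zero eigenvalues of $I-P_n$. Define $$\underline\theta_n=\min_{1\le i\le\mathfrak{r}_n}\theta_{n,i},\qquad\rho_n^2=\sum_{i=1}^{\mathfrak{r}_n}\frac{1-\theta_{n,i}}{\theta_{n,i}^2}.$$ Then, for each fixed $\epsilon\in(0,1)$, the family of chains $(X^{(n)})$ with transition kernels $(P_n)$, all started from $0$, has a separation cutoff if and only if $\mathrm{Tr}(\mathrm{R}_n)\,\underline\theta_n\to\infty$, if and only if $T_n^s(0,\epsilon)\,\underline\theta_n\to\infty$. In this case there is a $(\mathrm{Tr}(\mathrm{R}_n),\max\{\rho_n,1\})$ separation cutoff.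
   Context: $\mathcal{S}^M_{\mathfrak{r}}$ denotes the class $\mathcal{S}^M$ below on the state space $E_{\mathfrak{r}}=\{0,\dots,\mathfrak{r}\}$. $\mathcal{M}$: transition matrices $P$ on $E$ that are irreducible and upward skip-free ($p(x,x+1)>0$, $p(x,x+y)=0$ for $y\ge2$). $\mathcal{B}$: transition matrices on $E$ of irreducible (or with at most one absorbing or entrance state) birth-death chains ($Q\in\mathcal{M}$ with $Q(x,x-1)>0$ and $Q(x,x-y)=0$ for $y\ge2$), with reversible measure $\pi_Q$. $P\sim Q$ if there is a bounded linear operator $\Lambda:\ell^2(\pi_Q)\to\ell^2(\pi)$ with bounded inverse such that $P\Lambda=\Lambda Q$ ($\pi$ the stationary measure of $P$). $\mathcal{S}$ is the set of $P\in\mathcal{M}$ with $P\sim Q$ for some $Q\in\mathcal{B}$. $X\in\mathcal{S}^M$ if $X\in\mathcal{S}$ and its time-reversal $\widehat P$, $\pi(x)\widehat p(x,y)=\pi(y)p(y,x)$, is stochastically monotone: $y\mapsto\widehat{\mathbb{P}}_y(X_1\le x)$ is non-increasing for every $x$. $\mathrm{R}_n=(I-P_n)^{-1}$ restricted to $\ell_0^2(\pi_n)=\{f\in\ell^2(\pi_n):\langle\mathbf{1},f\rangle_{\pi_n}=0\}$, where $\pi_n$ is the stationary distribution of $P_n$. $\mathrm{sep}(P^k(x,\cdot),\pi)=\max_{y}\left[1-\frac{P^k(x,y)}{\pi(y)}\right]$, and $T_n^s(x,\epsilon)=\min\{k\ge0:\mathrm{sep}(P_n^k(x,\cdot),\pi_n)\le\epsilon\}$.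 The family started from $0$ has a separation cutoff if there is a positive sequence $(t_n)$ such that $\lim_{n\to\infty}T_n^s(0,\epsilon)/t_n=1$ for all $\epsilon\in(0,1)$. It has a $(t_n,b_n)$ separation cutoff if $(t_n),(b_n)$ are positive, $b_n/t_n\to0$ and $\limsup_{n\to\infty}\frac{|T_n^s(0,\epsilon)-t_n|}{b_n}<\infty$ for all $\epsilon\in(0,1)$.
   Formalization: In the first equivalence "has a separation cutoff" is replaced by "has a separation cutoff and Tr(R_n)→∞"; without this, two-state chains with all entries 1/2 have a cutoff (all times equal 1) although Tr(R_n)θ_n = 1. *)

theory Defs
  imports
    "HOL-Library.Extended_Real"
    "HOL-Library.Liminf_Limsup"
    "Jordan_Normal_Form.Char_Poly"
begin

text \<open>
  The state space is \<open>{0..r}\<close>. A transition matrix on it is a real matrix of dimension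
  \<open>Suc r\<close>, a function on it (and a measure on it) is a real vector of dimension \<open>Suc r\<close>.
\<close>

definition transition_matrix :: "nat \<Rightarrow> real mat \<Rightarrow> bool" where
  "transition_matrix r P \<longleftrightarrow>
     P \<in> carrier_mat (Suc r) (Suc r) \<and>
     (\<forall>x\<le>r. \<forall>y\<le>r. 0 \<le> P $$ (x, y)) \<and>
     (\<forall>x\<le>r. (\<Sum>y\<le>r. P $$ (x, y)) = 1)"

definition irreducible_mat :: "nat \<Rightarrow> real mat \<Rightarrow> bool" where
  "irreducible_mat r P \<longleftrightarrow> (\<forall>x\<le>r. \<forall>y\<le>r. \<exists>k. 0 < (P ^\<^sub>m k) $$ (x, y))"

definition period :: "real mat \<Rightarrow> nat \<Rightarrow> nat" where
  "period P x = Gcd {k. 1 \<le> k \<and> 0 < (P ^\<^sub>m k) $$ (x, x)}"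

definition ergodic :: "nat \<Rightarrow> real mat \<Rightarrow> bool" where
  "ergodic r P \<longleftrightarrow> irreducible_mat r P \<and> (\<forall>x\<le>r. period P x = 1)"

definition stationary :: "nat \<Rightarrow> real mat \<Rightarrow> real vec \<Rightarrow> bool" where
  "stationary r P \<mu> \<longleftrightarrow>
     \<mu> \<in> carrier_vec (Suc r) \<and>
     (\<forall>x\<le>r. 0 \<le> \<mu> $ x) \<and> (\<Sum>x\<le>r. \<mu> $ x) = 1 \<and>
     (\<forall>y\<le>r. (\<Sum>x\<le>r. \<mu> $ x * P $$ (x, y)) = \<mu> $ y)"

text \<open>Well defined whenever \<open>P\<close> is an irreducible transition matrix.\<close>
definition stat :: "nat \<Rightarrow> real mat \<Rightarrow> real vec" where
  "stat r P = (THE \<mu>. stationary r P \<mu>)"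

definition skip_free :: "nat \<Rightarrow> real mat set" where
  "skip_free r = {P. transition_matrix r P \<and> irreducible_mat r P \<and>
     (\<forall>x<r. 0 < P $$ (x, Suc x)) \<and>
     (\<forall>x\<le>r. \<forall>y\<le>r. x + 2 \<le> y \<longrightarrow> P $$ (x, y) = 0)}"

definition absorbing :: "nat \<Rightarrow> real mat \<Rightarrow> nat \<Rightarrow> bool" where
  "absorbing r Q a \<longleftrightarrow> (\<forall>y\<le>r. y \<noteq> a \<longrightarrow> Q $$ (a, y) = 0)"

definition entrance :: "nat \<Rightarrow> real mat \<Rightarrow> nat \<Rightarrow> bool" where
  "entrance r Q a \<longleftrightarrow> (\<forall>x\<le>r. x \<noteq> a \<longrightarrow> Q $$ (x, a) = 0)"

definition adjacent :: "nat \<Rightarrow> nat \<Rightarrow> bool" where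
  "adjacent x y \<longleftrightarrow> y = Suc x \<or> x = Suc y"

text \<open>
  The first disjunct is the irreducible case. In the other two all jumps to neighbours have
  positive probability, except those out of one absorbing, or into one entrance, state \<open>a\<close>.
\<close>
definition birth_death :: "nat \<Rightarrow> real mat set" where
  "birth_death r = {Q. transition_matrix r Q \<and>
     (\<forall>x\<le>r. \<forall>y\<le>r. x \<noteq> y \<and> \<not> adjacent x y \<longrightarrow> Q $$ (x, y) = 0) \<and>
     ((\<forall>x\<le>r. \<forall>y\<le>r. adjacent x y \<longrightarrow> 0 < Q $$ (x, y)) \<or>
      (\<exists>a\<le>r. absorbing r Q a \<and>
         (\<forall>x\<le>r. \<forall>y\<le>r. adjacent x y \<and> x \<noteq> a \<longrightarrow> 0 < Q $$ (x, y))) \<or>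
      (\<exists>a\<le>r. entrance r Q a \<and>
         (\<forall>x\<le>r. \<forall>y\<le>r. adjacent x y \<and> y \<noteq> a \<longrightarrow> 0 < Q $$ (x, y))))}"

definition reversible_measure :: "nat \<Rightarrow> real mat \<Rightarrow> real vec \<Rightarrow> bool" where
  "reversible_measure r Q \<mu> \<longleftrightarrow>
     \<mu> \<in> carrier_vec (Suc r) \<and> (\<forall>x\<le>r. 0 \<le> \<mu> $ x) \<and> (\<exists>x\<le>r. \<mu> $ x \<noteq> 0) \<and>
     (\<forall>x\<le>r. \<forall>y\<le>r. \<mu> $ x * Q $$ (x, y) = \<mu> $ y * Q $$ (y, x))"

definition l2_inner :: "real vec \<Rightarrow> real vec \<Rightarrow> real vec \<Rightarrow> real" where
  "l2_inner \<mu> f g = (\<Sum>x<dim_vec \<mu>. f $ x * g $ x * \<mu> $ x)"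

definition l2_norm :: "real vec \<Rightarrow> real vec \<Rightarrow> real" where
  "l2_norm \<mu> f = sqrt (l2_inner \<mu> f f)"

definition bounded_operator ::
  "real vec \<Rightarrow> real vec \<Rightarrow> (real vec \<Rightarrow> real vec) \<Rightarrow> bool" where
  "bounded_operator \<mu> \<nu> L \<longleftrightarrow>
     L \<in> carrier_vec (dim_vec \<mu>) \<rightarrow> carrier_vec (dim_vec \<nu>) \<and>
     (\<forall>f\<in>carrier_vec (dim_vec \<mu>). \<forall>g\<in>carrier_vec (dim_vec \<mu>). L (f + g) = L f + L g) \<and>
     (\<forall>c. \<forall>f\<in>carrier_vec (dim_vec \<mu>). L (c \<cdot>\<^sub>v f) = c \<cdot>\<^sub>v L f) \<and>
     (\<exists>C. \<forall>f\<in>carrier_vec (dim_vec \<mu>). l2_norm \<nu> (L f) \<le> C * l2_norm \<mu> f)"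

text \<open>
  Vectors are not identified modulo null sets. If \<open>\<mu>\<close> (the reversible measure of \<open>Q\<close>) vanishes
  somewhere, then \<open>l2(\<mu>)\<close> has smaller dimension than \<open>l2(stat r P)\<close> and there is no \<open>L\<close>;
  here this is reflected by the boundedness of \<open>L\<close>, which is then incompatible with injectivity.
\<close>
definition similar_chain :: "nat \<Rightarrow> real mat \<Rightarrow> real mat \<Rightarrow> real vec \<Rightarrow> bool" where
  "similar_chain r P Q \<mu> \<longleftrightarrow>
     (\<exists>L L'. bounded_operator \<mu> (stat r P) L \<and> bounded_operator (stat r P) \<mu> L' \<and>
        (\<forall>f\<in>carrier_vec (Suc r). L' (L f) = f) \<and>
        (\<forall>g\<in>carrier_vec (Suc r). L (L' g) = g) \<and>
        (\<forall>f\<in>carrier_vec (Suc r). P *\<^sub>v L f = L (Q *\<^sub>v f)))"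

definition class_S :: "nat \<Rightarrow> real mat set" where
  "class_S r = {P \<in> skip_free r.
     \<exists>Q\<in>birth_death r. \<exists>\<mu>. reversible_measure r Q \<mu> \<and> similar_chain r P Q \<mu>}"

definition time_reversal :: "nat \<Rightarrow> real mat \<Rightarrow> real mat" where
  "time_reversal r P =
     mat (Suc r) (Suc r) (\<lambda>(x, y). stat r P $ y * P $$ (y, x) / stat r P $ x)"

definition stochastically_monotone :: "nat \<Rightarrow> real mat \<Rightarrow> bool" where
  "stochastically_monotone r P \<longleftrightarrow>
     (\<forall>x\<le>r. \<forall>y\<le>r. \<forall>y'\<le>r. y \<le> y' \<longrightarrow> (\<Sum>z\<le>x. P $$ (y', z)) \<le> (\<Sum>z\<le>x. P $$ (y, z)))"

definition class_SM :: "nat \<Rightarrow> real mat set" where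
  "class_SM r = {P \<in> class_S r. stochastically_monotone r (time_reversal r P)}"

definition l2_centred :: "real vec \<Rightarrow> real vec set" where
  "l2_centred \<mu> = {f \<in> carrier_vec (dim_vec \<mu>). l2_inner \<mu> (vec (dim_vec \<mu>) (\<lambda>_. 1)) f = 0}"

definition resolvent_op :: "nat \<Rightarrow> real mat \<Rightarrow> real vec \<Rightarrow> real vec" where
  "resolvent_op r P = inv_into (l2_centred (stat r P)) (\<lambda>f. (1\<^sub>m (Suc r) - P) *\<^sub>v f)"

definition orthonormal_basis :: "real vec \<Rightarrow> real vec set \<Rightarrow> real vec set \<Rightarrow> bool" where
  "orthonormal_basis \<mu> V B \<longleftrightarrow>
     finite B \<and> B \<subseteq> V \<and>
     (\<forall>e\<in>B. \<forall>e'\<in>B. l2_inner \<mu> e e' = (if e = e' then 1 else 0)) \<and>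
     (\<forall>f\<in>V. (\<forall>e\<in>B. l2_inner \<mu> f e = 0) \<longrightarrow> f = 0\<^sub>v (dim_vec \<mu>))"

text \<open>The trace of a linear operator on \<open>V\<close>; it does not depend on the basis chosen.\<close>
definition op_trace :: "real vec \<Rightarrow> real vec set \<Rightarrow> (real vec \<Rightarrow> real vec) \<Rightarrow> real" where
  "op_trace \<mu> V T = (\<Sum>e\<in>(SOME B. orthonormal_basis \<mu> V B). l2_inner \<mu> (T e) e)"

definition Tr_R :: "nat \<Rightarrow> real mat \<Rightarrow> real" where
  "Tr_R r P = op_trace (stat r P) (l2_centred (stat r P)) (resolvent_op r P)"

text \<open>The eigenvalues are enumerated with algebraic multiplicity.\<close>
definition nonzero_eigenvalues :: "nat \<Rightarrow> real mat \<Rightarrow> (nat \<Rightarrow> real) \<Rightarrow> bool" where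
  "nonzero_eigenvalues r P \<theta> \<longleftrightarrow>
     image_mset \<theta> (mset_set {1..r}) =
       filter_mset (\<lambda>z. z \<noteq> 0) (proots (char_poly (1\<^sub>m (Suc r) - P)))"

definition theta_min :: "nat \<Rightarrow> (nat \<Rightarrow> real) \<Rightarrow> real" where
  "theta_min r \<theta> = Min (\<theta> ` {1..r})"

definition rho :: "nat \<Rightarrow> (nat \<Rightarrow> real) \<Rightarrow> real" where
  "rho r \<theta> = sqrt (\<Sum>i=1..r. (1 - \<theta> i) / (\<theta> i)\<^sup>2)"

definition sep :: "nat \<Rightarrow> real mat \<Rightarrow> nat \<Rightarrow> nat \<Rightarrow> real" where
  "sep r P k x = Max ((\<lambda>y. 1 - (P ^\<^sub>m k) $$ (x, y) / stat r P $ y) ` {0..r})"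

definition sep_time :: "nat \<Rightarrow> real mat \<Rightarrow> nat \<Rightarrow> real \<Rightarrow> nat" where
  "sep_time r P x \<epsilon> = (LEAST k. sep r P k x \<le> \<epsilon>)"

text \<open>
  The families are indexed by \<open>n \<ge> 1\<close>; their values at \<open>n = 0\<close> play no role.

  The sequence \<open>t\<close> is not required to tend to infinity. A family that reaches stationarity in a
  bounded time can therefore have a cutoff for trivial reasons: if every \<open>P n\<close> is the two-state
  matrix with all entries \<open>1/2\<close>, all separation times are \<open>1\<close> and \<open>t = (\<lambda>_. 1)\<close> will do.
\<close>

definition separation_cutoff :: "(nat \<Rightarrow> nat) \<Rightarrow> (nat \<Rightarrow> real mat) \<Rightarrow> bool" where
  "separation_cutoff r P \<longleftrightarrow>
     (\<exists>t :: nat \<Rightarrow> real. (\<forall>n\<ge>1. 0 < t n) \<and>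
        (\<forall>\<epsilon>. 0 < \<epsilon> \<and> \<epsilon> < 1 \<longrightarrow> (\<lambda>n. real (sep_time (r n) (P n) 0 \<epsilon>) / t n) \<longlonglongrightarrow> 1))"

definition separation_cutoff_window ::
  "(nat \<Rightarrow> nat) \<Rightarrow> (nat \<Rightarrow> real mat) \<Rightarrow> (nat \<Rightarrow> real) \<Rightarrow> (nat \<Rightarrow> real) \<Rightarrow> bool" where
  "separation_cutoff_window r P t b \<longleftrightarrow>
     (\<forall>n\<ge>1. 0 < t n \<and> 0 < b n) \<and> (\<lambda>n. b n / t n) \<longlonglongrightarrow> 0 \<and>
     (\<forall>\<epsilon>. 0 < \<epsilon> \<and> \<epsilon> < 1 \<longrightarrow>
        limsup (\<lambda>n. ereal (\<bar>real (sep_time (r n) (P n) 0 \<epsilon>) - t n\<bar> / b n)) < \<infinity>)"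

end

theory Submission
  imports Defs "HOL-Real_Asymp.Real_Asymp"
begin

text \<open>
  The separation distance of a chain of this class, started from \<open>0\<close>, is the tail of a law on the
  natural numbers whose generating function is a product over the eigenvalues. Everything else is
  a study of that law.

  \<^bold>\<open>From the chain to the law.\<close> Monotonicity of the time reversal makes
  \<open>P\<^sup>k(0, y) / \<pi>(y)\<close> non-increasing in \<open>y\<close> for all \<open>k\<close>, so the maximum in the separation distance
  is attained at \<open>y = r\<close>: \<open>sep(k) = 1 - F(k)\<close> with \<open>F(k) = P\<^sup>k(0, r) / \<pi>(r)\<close>. The same
  monotonicity shows that \<open>F\<close> is non-decreasing and at most \<open>1\<close> (\<open>sep_monotone\<close>). As \<open>P\<close> is upward
  skip-free, the entry \<open>(0, r)\<close> of the adjugate of \<open>x - (I - P)\<close> does not depend on \<open>x\<close>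
  (\<open>adjugate_corner\<close>), so Cramer's rule yields, for \<open>z = 1 / (1 + u)\<close> and \<open>u > 0\<close>,
  \<open>(1 - z) \<Sum>\<^sub>k F(k) z\<^sup>k = \<Prod>\<^sub>i \<theta>\<^sub>i / (\<theta>\<^sub>i + u)\<close> (\<open>corner_generating_function\<close>).
  Letting \<open>u\<close> tend to \<open>0\<close> shows that \<open>F\<close> is the distribution function of a random variable \<open>T\<close>,
  which has mean \<open>\<Sum>\<^sub>i 1 / \<theta>\<^sub>i\<close> and variance \<open>\<Sum>\<^sub>i (1 - \<theta>\<^sub>i) / \<theta>\<^sub>i\<^sup>2\<close>. If all \<open>\<theta>\<^sub>i\<close> are at most \<open>1\<close>, then
  \<open>T\<close> is a sum of independent geometric variables. In general some eigenvalues of \<open>P\<close> are negative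
  and there is no such decomposition, but in the variable \<open>u\<close> all factors look alike: they are
  Laplace transforms of exponential laws. All arguments use \<open>T\<close> only through this formula.

  \<^bold>\<open>The trace.\<close> The trace of the resolvent is the mean of \<open>T\<close> (\<open>Tr_R_eq\<close>). This is read off the same
  adjugate: its constant coefficient is a multiple of the projection onto the constants, its linear
  coefficient inverts \<open>I - P\<close> on the centred functions up to a scalar, and the trace of the adjugate
  is the derivative of the characteristic polynomial.

  \<^bold>\<open>The cutoff.\<close> Separation times are quantiles of \<open>T\<close>. Chebyshev's inequality puts them within a
  constant times \<open>max \<rho> 1\<close> of the mean (\<open>quantile_window\<close>), and \<open>\<rho>\<^sup>2\<close> is at most the mean divided by
  \<open>\<theta>\<^sub>m\<^sub>i\<^sub>n\<close>; so the window is negligible as soon as the product of mean and gap \<open>\<theta>\<^sub>m\<^sub>i\<^sub>n\<close> diverges.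
  Each quantile is comparable with the mean, with constants that depend on the level only
  (\<open>quantile_le_mean\<close>, \<open>mean_le_quantile\<close>), whence the equivalence of the two product conditions.

  Conversely, let \<open>T\<^sub>n / t\<^sub>n\<close> tend to \<open>1\<close> in probability, with means tending to infinity. By the
  comparison \<open>t\<^sub>n\<close> tends to infinity as well, so \<open>\<Prod>\<^sub>i \<theta>\<^sub>i / (\<theta>\<^sub>i + c / t\<^sub>n)\<close> tends to \<open>exp(-c)\<close> for
  each \<open>c > 0\<close>. The quotient of the value at \<open>c = 2\<close> by the square of the value at \<open>c = 1\<close> then tends
  to \<open>1\<close>; but it is a product of factors \<open>1 + a\<^sub>i\<^sup>2 / (1 + 2 a\<^sub>i)\<close> with \<open>a\<^sub>i = 1 / (t\<^sub>n \<theta>\<^sub>i)\<close>, all at least \<open>1\<close>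
  (\<open>lap_ratio_ge\<close>). Hence the largest \<open>a\<^sub>i\<close> tends to \<open>0\<close>, that is, \<open>t\<^sub>n \<theta>\<^sub>m\<^sub>i\<^sub>n\<close> diverges
  (\<open>cutoff_imp_gap\<close>).
\<close>

section \<open>Integer-valued laws with a rational generating function\<close>

lemma one_plus_sum_le_prod:
  fixes a :: "'i \<Rightarrow> real"
  assumes "finite I" and "\<And>i. i \<in> I \<Longrightarrow> 0 \<le> a i"
  shows "1 + (\<Sum>i\<in>I. a i) \<le> (\<Prod>i\<in>I. 1 + a i)"
  using assms
proof (induction I)
  case (insert j I)
  have "1 + (\<Sum>i\<in>I. a i) \<le> (\<Prod>i\<in>I. 1 + a i)"
    using insert by simp
  moreover have "0 \<le> (\<Sum>i\<in>I. a i)"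
    using insert.prems by (intro sum_nonneg) auto
  moreover have "0 \<le> a j" using insert.prems by simp
  ultimately have "1 * (1 + (\<Sum>i\<in>I. a i)) + a j * 1 \<le> (1 + a j) * (\<Prod>i\<in>I. 1 + a i)"
    unfolding distrib_right by (intro add_mono mult_mono) auto
  then show ?case using insert.hyps by (simp add: algebra_simps)
qed simp

text \<open>
  The cross terms in a product of factors \<open>1 + c\<^sub>i s\<^sup>2 + o(s\<^sup>2)\<close> are of order \<open>s\<^sup>4\<close>. Without linear
  terms, second-order coefficients are additive, just as variances of independent variables are.
\<close>
lemma tendsto_prod_second_order:
  fixes \<phi> :: "'i \<Rightarrow> real \<Rightarrow> real"
  assumes "finite I"
    and "\<And>i. i \<in> I \<Longrightarrow> ((\<lambda>s. (\<phi> i s - 1) / s\<^sup>2) \<longlongrightarrow> c i) (at_right 0)"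
  shows "((\<lambda>s. ((\<Prod>i\<in>I. \<phi> i s) - 1) / s\<^sup>2) \<longlongrightarrow> (\<Sum>i\<in>I. c i)) (at_right 0)"
  using assms
proof (induction I)
  case (insert j I)
  let ?p = "\<lambda>s. \<Prod>i\<in>I. \<phi> i s"
  have q: "((\<lambda>s. (\<phi> j s - 1) / s\<^sup>2) \<longlongrightarrow> c j) (at_right 0)"
    and p: "((\<lambda>s. (?p s - 1) / s\<^sup>2) \<longlongrightarrow> (\<Sum>i\<in>I. c i)) (at_right 0)"
    using insert by auto
  have s: "((\<lambda>s::real. s\<^sup>2) \<longlongrightarrow> 0) (at_right 0)" by real_asymp
  have nz: "eventually (\<lambda>s::real. s \<noteq> 0) (at_right 0)"
    by (simp add: eventually_at_filter)
  have "((\<lambda>s. (\<phi> j s - 1) / s\<^sup>2 + (?p s - 1) / s\<^sup>2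
      + (\<phi> j s - 1) / s\<^sup>2 * ((?p s - 1) / s\<^sup>2) * s\<^sup>2)
      \<longlongrightarrow> c j + (\<Sum>i\<in>I. c i) + c j * (\<Sum>i\<in>I. c i) * 0) (at_right 0)"
    by (intro tendsto_intros p q s)
  moreover have "eventually (\<lambda>s. (\<phi> j s - 1) / s\<^sup>2 + (?p s - 1) / s\<^sup>2
      + (\<phi> j s - 1) / s\<^sup>2 * ((?p s - 1) / s\<^sup>2) * s\<^sup>2
      = ((\<Prod>i\<in>insert j I. \<phi> i s) - 1) / s\<^sup>2) (at_right 0)"
    using nz by eventually_elim (use insert.hyps in \<open>simp add: field_simps\<close>)
  ultimately show ?case using insert.hyps by (auto elim: Lim_transform_eventually)
qed simp

text \<open>
  The law \<open>f\<close> has the generating function \<open>\<Prod>\<^sub>i \<theta>\<^sub>i z / (1 - (1 - \<theta>\<^sub>i) z)\<close>, written in the variable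
  \<open>u\<close> with \<open>z = 1 / (1 + u)\<close>. Values \<open>\<theta>\<^sub>i > 1\<close> occur; the factor of such an \<open>i\<close> is not itself a
  generating function with non-negative coefficients, but all factors are positive and decreasing
  in \<open>u\<close>. That \<open>f\<close> has total mass \<open>1\<close> follows from the formula.
\<close>
locale rational_pgf =
  fixes f :: "nat \<Rightarrow> real" and I :: "'i set" and \<theta> :: "'i \<Rightarrow> real"
  assumes fin: "finite I"
    and pos: "i \<in> I \<Longrightarrow> 0 < \<theta> i"
    and nonneg: "0 \<le> f k"
    and zero: "f 0 = 0"
    and pgf: "0 < u \<Longrightarrow> (\<lambda>k. f k * (1 / (1 + u)) ^ k) sums (\<Prod>i\<in>I. \<theta> i / (\<theta> i + u))"
begin

text \<open>
  With \<open>T\<close> distributed according to \<open>f\<close>, this is the expectation of \<open>(1 + u)\<^sup>-\<^sup>T\<close>, the Laplace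
  transform at \<open>u\<close> of a sum of \<open>T\<close> independent standard exponential variables, and also that of a
  sum of independent exponential variables with rates \<open>\<theta>\<^sub>i\<close>.
\<close>
definition lap :: "real \<Rightarrow> real" where
  "lap u = (\<Prod>i\<in>I. \<theta> i / (\<theta> i + u))"

definition mean :: real where
  "mean = (\<Sum>i\<in>I. 1 / \<theta> i)"

definition var :: real where
  "var = (\<Sum>i\<in>I. (1 - \<theta> i) / (\<theta> i)\<^sup>2)"

definition tail :: "nat \<Rightarrow> real" where
  "tail k = 1 - (\<Sum>j\<le>k. f j)"

definition quantile :: "real \<Rightarrow> nat" where
  "quantile \<epsilon> = (LEAST k. tail k \<le> \<epsilon>)"

lemma lap_altdef: "0 < u \<Longrightarrow> lap u = 1 / (\<Prod>i\<in>I. 1 + u / \<theta> i)"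
proof -
  assume u: "0 < u"
  have "\<theta> i / (\<theta> i + u) = 1 / (1 + u / \<theta> i)" if "i \<in> I" for i
  proof -
    have "0 < \<theta> i" using that by (rule pos)
    then show ?thesis using u by (simp add: divide_simps)
  qed
  then have "lap u = (\<Prod>i\<in>I. 1 / (1 + u / \<theta> i))"
    unfolding lap_def by (intro prod.cong) auto
  then show ?thesis by (simp add: prod_dividef)
qed

lemma mean_nonneg: "0 \<le> mean"
  unfolding mean_def using pos by (intro sum_nonneg) (auto intro: less_imp_le)

lemma lap_upper: "0 < u \<Longrightarrow> lap u \<le> 1 / (1 + u * mean)"
proof -
  assume u: "0 < u"
  have "1 + (\<Sum>i\<in>I. u / \<theta> i) \<le> (\<Prod>i\<in>I. 1 + u / \<theta> i)"
    using u pos by (intro one_plus_sum_le_prod fin) (auto intro: less_imp_le)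
  moreover have "(\<Sum>i\<in>I. u / \<theta> i) = u * mean"
    by (simp add: mean_def sum_distrib_left)
  ultimately show ?thesis
    using u mean_nonneg by (simp add: lap_altdef frac_le add_pos_nonneg)
qed

lemma lap_lower: "0 < u \<Longrightarrow> 1 - u * mean \<le> lap u"
proof -
  assume u: "0 < u"
  have "1 - (\<Sum>i\<in>J. u / \<theta> i) \<le> (\<Prod>i\<in>J. \<theta> i / (\<theta> i + u)) \<and> (\<Prod>i\<in>J. \<theta> i / (\<theta> i + u)) \<le> 1"
    if "finite J" "J \<subseteq> I" for J
    using that
  proof (induction J)
    case (insert j J)
    let ?p = "\<Prod>i\<in>J. \<theta> i / (\<theta> i + u)"
    have t: "0 < \<theta> j" using insert pos by auto
    have p: "1 - (\<Sum>i\<in>J. u / \<theta> i) \<le> ?p" "?p \<le> 1" using insert by auto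
    have p0: "0 \<le> ?p" using insert.prems u pos
      by (intro prod_nonneg) (auto simp: less_imp_le add_nonneg_nonneg)
    have a: "1 - u / \<theta> j \<le> \<theta> j / (\<theta> j + u)"
      using t u by (simp add: field_simps)
    have b: "\<theta> j / (\<theta> j + u) \<le> 1" "0 \<le> \<theta> j / (\<theta> j + u)" using t u by auto
    have "(1 - \<theta> j / (\<theta> j + u)) * ?p \<le> (1 - \<theta> j / (\<theta> j + u)) * 1"
      using b p by (intro mult_left_mono) auto
    then have "?p - (u / \<theta> j) \<le> \<theta> j / (\<theta> j + u) * ?p"
      using a by (simp add: algebra_simps)
    moreover have "\<theta> j / (\<theta> j + u) * ?p \<le> 1"
      using b p p0 by (intro mult_le_one) auto
    ultimately show ?case using insert.hyps p by simp
  qed simp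
  from this[OF fin order.refl] show ?thesis
    by (simp add: lap_def mean_def sum_distrib_left)
qed

lemma lap_tendsto_1: "(lap \<longlongrightarrow> 1) (at_right 0)"
proof (rule tendsto_sandwich)
  show "eventually (\<lambda>u. 1 - u * mean \<le> lap u) (at_right 0)"
    using eventually_at_right_less by eventually_elim (rule lap_lower)
  show "eventually (\<lambda>u. lap u \<le> 1 / (1 + u * mean)) (at_right 0)"
    using eventually_at_right_less by eventually_elim (rule lap_upper)
  show "((\<lambda>u. 1 - u * mean) \<longlongrightarrow> 1) (at_right 0)"
    by (rule tendsto_eq_intros | simp)+
  show "((\<lambda>u. 1 / (1 + u * mean)) \<longlongrightarrow> 1) (at_right 0)"
    by (rule tendsto_eq_intros | simp)+
qed

lemma pgf_partial_le: "0 < u \<Longrightarrow> finite A \<Longrightarrow> (\<Sum>k\<in>A. f k * (1 / (1 + u)) ^ k) \<le> lap u"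
  using pgf[of u] nonneg unfolding lap_def
  by (metis (no_types, lifting) sum_le_suminf sums_iff divide_nonneg_nonneg mult_nonneg_nonneg zero_le_power
      add_nonneg_nonneg less_imp_le zero_le_one)

lemma cdf_le_1: "finite A \<Longrightarrow> (\<Sum>k\<in>A. f k) \<le> 1"
proof -
  assume A: "finite A"
  have "((\<lambda>u. \<Sum>k\<in>A. f k * (1 / (1 + u)) ^ k) \<longlongrightarrow> (\<Sum>k\<in>A. f k * (1 / (1 + 0)) ^ k)) (at_right 0)"
    by (intro tendsto_intros) auto
  moreover have "eventually (\<lambda>u. (\<Sum>k\<in>A. f k * (1 / (1 + u)) ^ k) \<le> lap u) (at_right 0)"
    using eventually_at_right_less by eventually_elim (rule pgf_partial_le[OF _ A])
  ultimately show ?thesis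
    using tendsto_le[OF trivial_limit_at_right_real lap_tendsto_1] by fastforce
qed

lemma summable_f: "summable f"
  by (rule summableI_nonneg_bounded[of _ 1]) (use nonneg cdf_le_1 in auto)

text \<open>
  No mass escapes to infinity, since the generating function tends to \<open>1\<close> at the boundary of
  the unit disc.
\<close>
lemma total_mass: "f sums 1"
proof -
  have "lap u \<le> suminf f" if u: "0 < u" for u
  proof -
    have "f k * (1 / (1 + u)) ^ k \<le> f k" for k
      using u nonneg[of k] by (intro mult_right_le_one_le) (auto simp: power_le_one)
    then show ?thesis
      using sums_le[OF _ pgf[OF u] summable_sums[OF summable_f]] by (simp add: lap_def)
  qed
  then have "eventually (\<lambda>u. lap u \<le> suminf f) (at_right 0)"
    using eventually_at_right_less[of "0::real"] by (auto elim: eventually_mono)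
  then have "1 \<le> suminf f"
    by (rule tendsto_upperbound[OF lap_tendsto_1]) simp
  moreover have "suminf f \<le> 1"
    by (rule suminf_le_const[OF summable_f]) (simp add: cdf_le_1)
  ultimately show ?thesis using summable_sums[OF summable_f] by simp
qed

lemma tail_sums: "(\<lambda>j. if k < j then f j else 0) sums tail k"
proof -
  have "(\<lambda>j. if j \<in> {..k} then f j else 0) sums (\<Sum>j\<le>k. f j)"
    by (rule sums_If_finite_set) simp
  from sums_diff[OF total_mass this] show ?thesis
    unfolding tail_def by (rule sums_cong[THEN iffD1, rotated]) auto
qed

lemma tail_0: "tail 0 = 1"
  by (simp add: tail_def zero)

lemma tail_quantile: "0 < \<epsilon> \<Longrightarrow> tail (quantile \<epsilon>) \<le> \<epsilon>"
proof -
  assume e: "0 < \<epsilon>"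
  have "(\<lambda>n. \<Sum>j\<le>n. f j) \<longlonglongrightarrow> 1"
    using total_mass by (simp add: sums_def_le)
  then have "tail \<longlonglongrightarrow> 0"
    unfolding tail_def by (auto intro!: tendsto_eq_intros)
  then have "eventually (\<lambda>k. tail k < \<epsilon>) sequentially"
    using e by (rule order_tendstoD)
  then obtain k where "tail k \<le> \<epsilon>"
    by (metis eventually_sequentially less_imp_le order.refl)
  then show ?thesis unfolding quantile_def by (rule LeastI)
qed

lemma tail_before_quantile: "k < quantile \<epsilon> \<Longrightarrow> \<epsilon> < tail k"
  unfolding quantile_def using not_less_Least by fastforce

lemma quantile_pos: "0 < \<epsilon> \<Longrightarrow> \<epsilon> < 1 \<Longrightarrow> 1 \<le> quantile \<epsilon>"
  using tail_quantile[of \<epsilon>] tail_0 by (cases "quantile \<epsilon>") auto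

lemma lap_ge_quantile:
  assumes "0 < \<epsilon>" "\<epsilon> < 1" "0 < u"
  shows "(1 - \<epsilon>) * (1 / (1 + u)) ^ quantile \<epsilon> \<le> lap u"
proof -
  let ?z = "1 / (1 + u)" and ?k = "quantile \<epsilon>"
  have z: "0 \<le> ?z" "?z \<le> 1" using assms by auto
  have "(1 - \<epsilon>) * ?z ^ ?k \<le> (\<Sum>j\<le>?k. f j) * ?z ^ ?k"
    using tail_quantile[of \<epsilon>] assms by (intro mult_right_mono) (auto simp: tail_def)
  also have "\<dots> \<le> (\<Sum>j\<le>?k. f j * ?z ^ j)"
    unfolding sum_distrib_right using z nonneg
    by (intro sum_mono mult_left_mono power_decreasing) auto
  also have "\<dots> \<le> lap u" by (rule pgf_partial_le) (use assms in auto)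
  finally show ?thesis .
qed

lemma lap_le_quantile:
  assumes "0 < \<epsilon>" "\<epsilon> < 1" "0 < u"
  shows "lap u \<le> \<epsilon> + (1 / (1 + u)) ^ quantile (1 - \<epsilon>)"
proof -
  let ?z = "1 / (1 + u)" and ?q = "quantile (1 - \<epsilon>)"
  have z: "0 \<le> ?z" "?z \<le> 1" using assms by auto
  have q: "1 \<le> ?q" by (rule quantile_pos) (use assms in auto)
  have "(\<lambda>j. (if j \<in> {..?q - 1} then f j else 0) + f j * ?z ^ ?q)
      sums ((\<Sum>j\<in>{..?q - 1}. f j) + 1 * ?z ^ ?q)"
    by (intro sums_add sums_mult2 total_mass sums_If_finite_set) simp
  moreover have "f j * ?z ^ j \<le> (if j \<in> {..?q - 1} then f j else 0) + f j * ?z ^ ?q" for j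
  proof (cases "j \<le> ?q - 1")
    case True
    have "f j * ?z ^ j \<le> f j * 1"
      using z nonneg by (intro mult_left_mono power_le_one) auto
    moreover have "0 \<le> f j * ?z ^ ?q" using z nonneg by auto
    ultimately show ?thesis using True by auto
  next
    case False
    have "f j * ?z ^ j \<le> f j * ?z ^ ?q"
      using z nonneg False by (intro mult_left_mono power_decreasing) auto
    then show ?thesis using False by auto
  qed
  ultimately have "lap u \<le> (\<Sum>j\<in>{..?q - 1}. f j) + 1 * ?z ^ ?q"
    unfolding lap_def by (intro sums_le[OF _ pgf[OF assms(3)]])
  moreover have "(\<Sum>j\<in>{..?q - 1}. f j) \<le> \<epsilon>"
    using tail_before_quantile[of "?q - 1" "1 - \<epsilon>"] q by (auto simp: tail_def)
  ultimately show ?thesis by simp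
qed

text \<open>
  A form of Markov's inequality that needs the generating function only: with \<open>u = 1 / k\<close> the
  function \<open>1 - z\<^sup>j\<close> is at least \<open>1/2\<close> for \<open>j \<ge> k\<close>, and its expectation is at most \<open>u\<close> times the
  mean.
\<close>
lemma quantile_le_mean:
  assumes "0 < \<epsilon>" "\<epsilon> < 1"
  shows "real (quantile \<epsilon>) \<le> 2 / \<epsilon> * mean"
proof -
  define k where "k = quantile \<epsilon>"
  have k: "1 \<le> k" unfolding k_def by (rule quantile_pos[OF assms])
  define u where "u = 1 / real k"
  have u: "0 < u" using k by (simp add: u_def)
  let ?z = "1 / (1 + u)"
  have z: "0 \<le> ?z" "?z \<le> 1" using u by auto
  have "1 + real k * u \<le> (1 + u) ^ k" using u by (intro Bernoulli_inequality) auto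
  then have "2 \<le> (1 + u) ^ k" using k by (simp add: u_def)
  then have zk: "?z ^ k \<le> 1 / 2"
    by (simp add: power_one_over frac_le)
  have "tail (k - 1) * (1 / 2) \<le> 1 - lap u"
  proof (rule sums_le)
    show "(\<lambda>j. (if k - 1 < j then f j else 0) * (1 / 2)) sums (tail (k - 1) * (1 / 2))"
      by (intro sums_mult2 tail_sums)
    show "(\<lambda>j. f j - f j * ?z ^ j) sums (1 - lap u)"
      unfolding lap_def by (intro sums_diff total_mass pgf u)
    fix j
    show "(if k - 1 < j then f j else 0) * (1 / 2) \<le> f j - f j * ?z ^ j"
    proof (cases "k - 1 < j")
      case True
      then have "?z ^ j \<le> 1 / 2"
        using zk power_decreasing[of k j ?z] z by linarith
      then have "f j * ?z ^ j \<le> f j * (1 / 2)" using nonneg by (intro mult_left_mono) auto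
      then show ?thesis using True by simp
    next
      case False
      have "f j * ?z ^ j \<le> f j * 1" using z nonneg by (intro mult_left_mono power_le_one) auto
      then show ?thesis using False by simp
    qed
  qed
  moreover have "\<epsilon> < tail (k - 1)"
    using tail_before_quantile[of "k - 1" \<epsilon>] k by (simp add: k_def)
  moreover have "1 - lap u \<le> u * mean" using lap_lower[OF u] by simp
  ultimately have "\<epsilon> \<le> 2 * (u * mean)" by simp
  then show ?thesis using k assms unfolding u_def k_def[symmetric] by (simp add: field_simps)
qed

text \<open>
  A bounded quantile forces a bounded mean, which fails for general laws. Here, the mass
  \<open>1 - \<epsilon>\<close> up to the quantile \<open>k\<close> keeps the Laplace transform at \<open>u = 1 / k\<close> away from \<open>0\<close>, while the product formula
  bounds it by \<open>1 / (1 + u m)\<close>, with \<open>m\<close> the mean.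
\<close>
lemma mean_le_quantile:
  assumes "0 < \<epsilon>" "\<epsilon> < 1"
  shows "mean \<le> 3 / (1 - \<epsilon>) * real (quantile \<epsilon>)"
proof -
  define k where "k = quantile \<epsilon>"
  have k: "1 \<le> k" unfolding k_def by (rule quantile_pos[OF assms])
  define u where "u = 1 / real k"
  have u: "0 < u" using k by (simp add: u_def)
  have "(1 + u) ^ k \<le> exp u ^ k" using u by (intro power_mono exp_ge_add_one_self) auto
  also have "\<dots> = exp 1" using k by (simp add: exp_of_nat_mult[symmetric] u_def)
  also have "\<dots> \<le> 3" by (rule exp_le)
  finally have "1 / 3 \<le> (1 / (1 + u)) ^ k"
    using u by (simp add: power_one_over frac_le)
  then have "(1 - \<epsilon>) * (1 / 3) \<le> (1 - \<epsilon>) * (1 / (1 + u)) ^ k"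
    using assms by (intro mult_left_mono) auto
  also have "\<dots> \<le> lap u" unfolding k_def by (rule lap_ge_quantile[OF assms u])
  also have "\<dots> \<le> 1 / (1 + u * mean)" by (rule lap_upper[OF u])
  finally have "(1 - \<epsilon>) * (1 / 3) \<le> 1 / (1 + u * mean)" .
  moreover have "0 < 1 + u * mean" using u mean_nonneg by (simp add: add_pos_nonneg)
  ultimately have "(1 - \<epsilon>) * (1 + u * mean) \<le> 3"
    by (simp add: pos_le_divide_eq)
  moreover have "(1 - \<epsilon>) * (u * mean) \<le> (1 - \<epsilon>) * (1 + u * mean)"
    using assms by (intro mult_left_mono) auto
  ultimately have "(1 - \<epsilon>) * (u * mean) \<le> 3" by linarith
  then show ?thesis using k assms unfolding u_def k_def[symmetric] by (simp add: field_simps)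
qed

text \<open>
  After centring at the mean, each factor has no linear term at \<open>s = 0\<close>, where \<open>u = exp s - 1\<close>,
  and its quadratic coefficient is half of \<open>(1 - \<theta>\<^sub>i) / \<theta>\<^sub>i\<^sup>2\<close>, whatever the sign of \<open>1 - \<theta>\<^sub>i\<close>.
\<close>
lemma lap_second_order:
  "((\<lambda>s. (exp (s * mean) * lap (exp s - 1) - 1) / s\<^sup>2) \<longlongrightarrow> var / 2) (at_right 0)"
proof -
  have "((\<lambda>s. ((\<Prod>i\<in>I. exp (s / \<theta> i) * (\<theta> i / (\<theta> i + (exp s - 1)))) - 1) / s\<^sup>2)
      \<longlongrightarrow> (\<Sum>i\<in>I. (1 - \<theta> i) / (2 * (\<theta> i)\<^sup>2))) (at_right 0)"
  proof (rule tendsto_prod_second_order[OF fin])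
    fix i assume "i \<in> I"
    then have t: "0 < \<theta> i" by (rule pos)
    have "(1 - \<theta> i) / (2 * (\<theta> i)\<^sup>2)
      = \<theta> i * (inverse (\<theta> i) * (inverse (\<theta> i) * inverse (\<theta> i) - inverse (\<theta> i) / 2))
        - \<theta> i * (inverse (\<theta> i) * (inverse (\<theta> i) * inverse (\<theta> i))) / 2"
      using t by (simp add: field_simps power2_eq_square)
    then show "((\<lambda>s. (exp (s / \<theta> i) * (\<theta> i / (\<theta> i + (exp s - 1))) - 1) / s\<^sup>2)
        \<longlongrightarrow> (1 - \<theta> i) / (2 * (\<theta> i)\<^sup>2)) (at_right 0)"
      using t by (simp only:) real_asymp
  qed
  moreover have "(\<Prod>i\<in>I. exp (s / \<theta> i) * (\<theta> i / (\<theta> i + (exp s - 1))))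
      = exp (s * mean) * lap (exp s - 1)" for s
  proof -
    have "exp (s * mean) = (\<Prod>i\<in>I. exp (s / \<theta> i))"
      by (simp add: mean_def sum_distrib_left exp_sum[OF fin])
    then show ?thesis by (simp only: lap_def prod.distrib)
  qed
  moreover have "(\<Sum>i\<in>I. (1 - \<theta> i) / (2 * (\<theta> i)\<^sup>2)) = var / 2"
    by (simp add: var_def sum_divide_distrib mult.commute)
  ultimately show ?thesis by simp
qed

text \<open>
  Second moments are replaced by the expectation of \<open>(1 - exp(s (m - T)))\<^sup>2 / s\<^sup>2\<close>, with \<open>m\<close> the mean,
  which the product formula gives in closed form and which tends to the variance as \<open>s\<close> decreases
  to \<open>0\<close>. On the event \<open>A\<close> the integrand is at least \<open>((1 - exp(-s a)) / s)\<^sup>2\<close>, which tends to \<open>a\<^sup>2\<close>.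
\<close>
lemma chebyshev:
  assumes "0 < a" and A: "\<And>k. k \<in> A \<Longrightarrow> a \<le> \<bar>real k - mean\<bar>"
    and S: "(\<lambda>k. if k \<in> A then f k else 0) sums S"
  shows "S * a\<^sup>2 \<le> var"
proof -
  let ?\<Phi> = "\<lambda>s. exp (s * mean) * lap (exp s - 1)"
  let ?\<psi> = "\<lambda>s k. (1 - exp (s * (mean - real k)))\<^sup>2"
  have E: "(\<lambda>k. f k * ?\<psi> s k) sums (1 - 2 * ?\<Phi> s + ?\<Phi> (2 * s))" if s: "0 < s" for s
  proof -
    have pg: "(\<lambda>k. f k * exp (- (c * real k))) sums lap (exp c - 1)" if "0 < c" for c
    proof -
      have "(1 / (1 + (exp c - 1))) ^ k = exp (- (c * real k))" for k
        by (simp add: exp_minus power_one_over exp_of_nat_mult[symmetric] inverse_eq_divide mult.commute)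
      then show ?thesis using pgf[of "exp c - 1"] that by (simp add: lap_def)
    qed
    have "(\<lambda>k. f k - 2 * (exp (s * mean) * (f k * exp (- (s * real k))))
        + exp (2 * s * mean) * (f k * exp (- (2 * s * real k))))
        sums (1 - 2 * ?\<Phi> s + ?\<Phi> (2 * s))"
      by (intro sums_add sums_diff sums_mult total_mass pg) (use s in auto)
    moreover have "f k - 2 * (exp (s * mean) * (f k * exp (- (s * real k))))
        + exp (2 * s * mean) * (f k * exp (- (2 * s * real k))) = f k * ?\<psi> s k" for k
    proof -
      have "exp (s * (mean - real k)) = exp (s * mean) * exp (- (s * real k))"
        by (simp add: exp_add[symmetric] algebra_simps)
      moreover have "exp (2 * s * mean) = (exp (s * mean))\<^sup>2"
        "exp (- (2 * s * real k)) = (exp (- (s * real k)))\<^sup>2"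
        by (simp_all add: power2_eq_square exp_add[symmetric])
      ultimately show ?thesis by (simp add: power2_eq_square algebra_simps)
    qed
    ultimately show ?thesis by simp
  qed
  have le: "S * (1 - exp (- (s * a)))\<^sup>2 \<le> 1 - 2 * ?\<Phi> s + ?\<Phi> (2 * s)" if s: "0 < s" for s
  proof (rule sums_le[OF _ sums_mult2[OF S] E[OF s]])
    fix k
    show "(if k \<in> A then f k else 0) * (1 - exp (- (s * a)))\<^sup>2 \<le> f k * ?\<psi> s k"
    proof (cases "k \<in> A")
      case True
      have 0: "0 \<le> 1 - exp (- (s * a))" using s assms(1) by simp
      have "1 - exp (- (s * a)) \<le> \<bar>1 - exp (s * (mean - real k))\<bar>"
      proof (cases "real k \<ge> mean")
        case c: True
        then have "s * (mean - real k) \<le> s * (- a)"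
          using A[OF True] s by (intro mult_left_mono) auto
        then have "exp (s * (mean - real k)) \<le> exp (- (s * a))" by simp
        then show ?thesis by linarith
      next
        case c: False
        then have "s * a \<le> s * (mean - real k)"
          using A[OF True] s by (intro mult_left_mono) auto
        then have "exp (s * a) \<le> exp (s * (mean - real k))" by simp
        moreover have "1 - exp (- (s * a)) \<le> exp (s * a) - 1"
        proof -
          \<comment> \<open>Below the mean the exponential grows, and \<open>exp t - 1 \<ge> 1 - exp(-t)\<close>.\<close>
          have "2 \<le> exp (s * a) + exp (- (s * a))"
            using exp_ge_add_one_self[of "s * a"] exp_ge_add_one_self[of "- (s * a)"] by linarith
          then show ?thesis by simp
        qed
        ultimately show ?thesis by linarith
      qed
      then have "(1 - exp (- (s * a)))\<^sup>2 \<le> ?\<psi> s k"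
        using power_mono[OF _ 0, of "\<bar>1 - exp (s * (mean - real k))\<bar>" 2] by simp
      then show ?thesis using True nonneg by (simp add: mult_left_mono)
    next
      case False
      then show ?thesis using nonneg by simp
    qed
  qed
  have "((\<lambda>s. S * ((1 - exp (- (s * a))) / s)\<^sup>2) \<longlongrightarrow> S * a\<^sup>2) (at_right 0)"
  proof -
    have "((\<lambda>s. (1 - exp (- (s * a))) / s) \<longlongrightarrow> a) (at_right 0)"
      using assms(1) by real_asymp
    then show ?thesis by (intro tendsto_mult tendsto_const tendsto_power)
  qed
  moreover have "((\<lambda>s. (1 - 2 * ?\<Phi> s + ?\<Phi> (2 * s)) / s\<^sup>2) \<longlongrightarrow> var) (at_right 0)"
  proof -
    have "filterlim (\<lambda>s::real. 2 * s) (at_right 0) (at_right 0)" by real_asymp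
    from filterlim_compose[OF lap_second_order this]
    have "((\<lambda>s. (?\<Phi> (2 * s) - 1) / (2 * s)\<^sup>2) \<longlongrightarrow> var / 2) (at_right 0)" .
    then have "((\<lambda>s. 4 * ((?\<Phi> (2 * s) - 1) / (2 * s)\<^sup>2) - 2 * ((?\<Phi> s - 1) / s\<^sup>2))
        \<longlongrightarrow> 4 * (var / 2) - 2 * (var / 2)) (at_right 0)"
      by (intro tendsto_diff tendsto_mult tendsto_const lap_second_order)
    moreover have "4 * ((?\<Phi> (2 * s) - 1) / (2 * s)\<^sup>2) - 2 * ((?\<Phi> s - 1) / s\<^sup>2)
        = (1 - 2 * ?\<Phi> s + ?\<Phi> (2 * s)) / s\<^sup>2" for s
      by (simp add: power_mult_distrib diff_divide_distrib add_divide_distrib)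
    ultimately show ?thesis by simp
  qed
  moreover have "eventually (\<lambda>s. S * ((1 - exp (- (s * a))) / s)\<^sup>2
      \<le> (1 - 2 * ?\<Phi> s + ?\<Phi> (2 * s)) / s\<^sup>2) (at_right 0)"
    using eventually_at_right_less
  proof eventually_elim
    case (elim s)
    have "S * ((1 - exp (- (s * a))) / s)\<^sup>2 = S * (1 - exp (- (s * a)))\<^sup>2 / s\<^sup>2"
      by (simp add: power_divide)
    also have "\<dots> \<le> (1 - 2 * ?\<Phi> s + ?\<Phi> (2 * s)) / s\<^sup>2"
      using le[OF elim] by (rule divide_right_mono) simp
    finally show ?case .
  qed
  ultimately show ?thesis using tendsto_le[OF trivial_limit_at_right_real] by blast
qed

text \<open>
  A general \<open>b\<close> with \<open>var \<le> b\<^sup>2\<close> takes the place of the standard deviation, which is \<open>0\<close> for a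
  deterministic law and then could not be divided by.
\<close>
lemma quantile_window:
  assumes "0 < \<epsilon>" "\<epsilon> < 1" "0 < b" "var \<le> b\<^sup>2"
  shows "\<bar>real (quantile \<epsilon>) - mean\<bar> \<le> (1 / sqrt \<epsilon> + 2 / sqrt (1 - \<epsilon>)) * b"
proof -
  let ?k = "quantile \<epsilon>"
  have k: "1 \<le> ?k" by (rule quantile_pos[OF assms(1,2)])
  \<comment> \<open>The quantile is minimal, so the tail at \<open>?k - 1\<close> still exceeds \<open>\<epsilon>\<close>.\<close>
  have "real ?k < mean + b / sqrt \<epsilon>"
  proof (rule ccontr)
    assume far: "\<not> ?thesis"
    have "tail (?k - 1) * (b / sqrt \<epsilon>)\<^sup>2 \<le> var"
    proof (rule chebyshev[where A = "{?k - 1<..}"])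
      fix j assume "j \<in> {?k - 1<..}"
      then have "?k \<le> j" by auto
      then show "b / sqrt \<epsilon> \<le> \<bar>real j - mean\<bar>" using far by linarith
    qed (use assms tail_sums in auto)
    also have "\<dots> \<le> b\<^sup>2" by fact
    finally have "tail (?k - 1) \<le> \<epsilon>"
      using assms by (simp add: power_divide field_simps)
    then show False using tail_before_quantile[of "?k - 1" \<epsilon>] k by auto
  qed
  \<comment> \<open>The factor \<open>2\<close> makes the bound on the mass up to \<open>?k\<close> strictly smaller than \<open>1 - \<epsilon>\<close>.\<close>
  moreover have "mean - 2 * b / sqrt (1 - \<epsilon>) < real ?k"
  proof (rule ccontr)
    assume near: "\<not> ?thesis"
    have "(\<Sum>j\<le>?k. f j) * (2 * b / sqrt (1 - \<epsilon>))\<^sup>2 \<le> var"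
    proof (rule chebyshev[where A = "{..?k}"])
      fix j assume "j \<in> {..?k}"
      then have "real j \<le> real ?k" by auto
      then show "2 * b / sqrt (1 - \<epsilon>) \<le> \<bar>real j - mean\<bar>" using near by linarith
    next
      show "(\<lambda>j. if j \<in> {..?k} then f j else 0) sums (\<Sum>j\<le>?k. f j)"
        by (rule sums_If_finite_set) simp
    qed (use assms in simp)
    also have "\<dots> \<le> b\<^sup>2" by fact
    finally have "((\<Sum>j\<le>?k. f j) * 4 / (1 - \<epsilon>)) * b\<^sup>2 \<le> 1 * b\<^sup>2"
      using assms by (simp add: power_divide power_mult_distrib mult_ac)
    then have "(\<Sum>j\<le>?k. f j) * 4 / (1 - \<epsilon>) \<le> 1"
      by (rule mult_right_le_imp_le) (use assms in simp)
    then have "(\<Sum>j\<le>?k. f j) * 4 \<le> 1 - \<epsilon>"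
      using assms by simp
    then show False using tail_quantile[OF assms(1)] assms by (simp add: tail_def)
  qed
  moreover have "0 < b / sqrt \<epsilon>" "0 < 2 * b / sqrt (1 - \<epsilon>)" using assms by auto
  ultimately have "\<bar>real ?k - mean\<bar> \<le> b / sqrt \<epsilon> + 2 * b / sqrt (1 - \<epsilon>)"
    by linarith
  then show ?thesis by (simp add: algebra_simps)
qed

text \<open>
  For the Laplace transform \<open>exp(-t u)\<close> of a constant \<open>t\<close> this quotient is \<open>1\<close>, so its distance
  from \<open>1\<close> measures dispersion. It factorises over the \<open>\<theta>\<^sub>i\<close> into factors \<open>(1 + a)\<^sup>2 / (1 + 2 a) \<ge> 1\<close> with \<open>a = u / \<theta>\<^sub>i\<close>,
  so each single factor is a lower bound.
\<close>
lemma lap_ratio_ge: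
  assumes u: "0 < u" and i: "i \<in> I"
  shows "1 + (u / \<theta> i)\<^sup>2 / (1 + 2 * (u / \<theta> i)) \<le> lap (2 * u) / (lap u)\<^sup>2"
proof -
  let ?g = "\<lambda>i. 1 + (u / \<theta> i)\<^sup>2 / (1 + 2 * (u / \<theta> i))"
  have g1: "1 \<le> ?g j" if "j \<in> I" for j
    using pos[OF that] u by simp
  have g: "?g j = (1 + u / \<theta> j)\<^sup>2 / (1 + 2 * u / \<theta> j)" if "j \<in> I" for j
  proof -
    have "0 < 1 + 2 * w \<Longrightarrow> 1 + w\<^sup>2 / (1 + 2 * w) = (1 + w)\<^sup>2 / (1 + 2 * w)" for w :: real
      by (simp add: add_divide_eq_iff power2_eq_square algebra_simps)
    from this[of "u / \<theta> j"] show ?thesis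
      using pos[OF that] u by (simp add: add_pos_pos)
  qed
  have "?g i * 1 \<le> ?g i * (\<Prod>j\<in>I - {i}. ?g j)"
    using g1 i by (intro mult_left_mono prod_ge_1) (auto intro: order.trans[OF zero_le_one])
  also have "\<dots> = (\<Prod>j\<in>I. ?g j)"
    using i fin by (simp add: prod.remove)
  also have "\<dots> = (\<Prod>j\<in>I. (1 + u / \<theta> j)\<^sup>2 / (1 + 2 * u / \<theta> j))"
    by (intro prod.cong refl g)
  also have "\<dots> = lap (2 * u) / (lap u)\<^sup>2"
    using u by (simp add: lap_altdef prod_dividef prod_power_distrib power_divide)
  finally show ?thesis by simp
qed

end

section \<open>Concentration along a family of such laws\<close>

lemma filterlim_at_top_of_le_mult:
  fixes x y :: "nat \<Rightarrow> real"
  assumes "filterlim x at_top sequentially" and "0 < C"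
    and "\<And>n. 1 \<le> n \<Longrightarrow> x n \<le> C * y n"
  shows "filterlim y at_top sequentially"
proof (rule filterlim_at_top_mono)
  show "filterlim (\<lambda>n. x n * (1 / C)) at_top sequentially"
    using assms by (intro filterlim_at_top_mult_tendsto_pos[OF tendsto_const]) auto
  show "eventually (\<lambda>n. x n * (1 / C) \<le> y n) sequentially"
    using eventually_ge_at_top[of 1]
    by eventually_elim (use assms in \<open>simp add: field_simps\<close>)
qed

text \<open>
  Convergence of \<open>T / t\<close> to \<open>1\<close> in probability will be used through the values
  \<open>(1 + c / t)\<^sup>-\<^sup>q\<close> at the quantiles \<open>q\<close>.
\<close>
lemma tendsto_geometric_exp:
  fixes t :: "nat \<Rightarrow> real" and q :: "nat \<Rightarrow> nat"
  assumes "filterlim t at_top sequentially"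
    and "(\<lambda>n. real (q n) / t n) \<longlonglongrightarrow> 1" and "0 < c"
  shows "(\<lambda>n. (1 / (1 + c / t n)) ^ q n) \<longlonglongrightarrow> exp (- c)"
proof -
  have "((\<lambda>s::real. s * ln (1 + c / s)) \<longlongrightarrow> c) at_top"
    using assms(3) by real_asymp
  from filterlim_compose[OF this assms(1)]
  have "(\<lambda>n. t n * ln (1 + c / t n)) \<longlonglongrightarrow> c" .
  then have "(\<lambda>n. exp (- ((real (q n) / t n) * (t n * ln (1 + c / t n))))) \<longlonglongrightarrow> exp (- (1 * c))"
    by (intro tendsto_exp tendsto_minus tendsto_mult assms)
  moreover have "eventually (\<lambda>n. exp (- ((real (q n) / t n) * (t n * ln (1 + c / t n))))
      = (1 / (1 + c / t n)) ^ q n) sequentially"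
    using assms(1)[unfolded filterlim_at_top_dense, rule_format, of 0]
  proof eventually_elim
    case (elim n)
    have p: "0 < 1 + c / t n" using elim assms(3) by (simp add: add_pos_pos)
    have "exp (real (q n) * ln (1 + c / t n)) = (1 + c / t n) ^ q n"
      using p by (simp add: exp_of_nat_mult)
    then show ?case using elim by (simp add: exp_minus power_one_over inverse_eq_divide)
  qed
  ultimately show ?thesis by (auto elim: Lim_transform_eventually)
qed

locale rational_pgf_family =
  fixes f :: "nat \<Rightarrow> nat \<Rightarrow> real" and I :: "nat \<Rightarrow> 'i set" and \<theta> :: "nat \<Rightarrow> 'i \<Rightarrow> real"
  assumes law: "1 \<le> n \<Longrightarrow> rational_pgf (f n) (I n) (\<theta> n)"
    and nonempty: "1 \<le> n \<Longrightarrow> I n \<noteq> {}"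
    and le_2: "1 \<le> n \<Longrightarrow> i \<in> I n \<Longrightarrow> \<theta> n i \<le> 2"
begin

definition m :: "nat \<Rightarrow> real" where "m n = rational_pgf.mean (I n) (\<theta> n)"
definition v :: "nat \<Rightarrow> real" where "v n = rational_pgf.var (I n) (\<theta> n)"
definition q :: "nat \<Rightarrow> real \<Rightarrow> nat" where "q n = rational_pgf.quantile (f n)"
definition gap :: "nat \<Rightarrow> real" where "gap n = Min (\<theta> n ` I n)"

lemma gap_le: "1 \<le> n \<Longrightarrow> i \<in> I n \<Longrightarrow> gap n \<le> \<theta> n i"
  unfolding gap_def using rational_pgf.fin[OF law] by (intro Min_le) auto

lemma gap_attained: "1 \<le> n \<Longrightarrow> \<exists>i\<in>I n. gap n = \<theta> n i"
proof -
  assume n: "1 \<le> n"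
  have "Min (\<theta> n ` I n) \<in> \<theta> n ` I n"
    using rational_pgf.fin[OF law[OF n]] nonempty[OF n] by (intro Min_in) auto
  then show ?thesis unfolding gap_def by (elim imageE) blast
qed

lemma gap_pos: "1 \<le> n \<Longrightarrow> 0 < gap n"
  using gap_attained rational_pgf.pos[OF law] by metis

lemma gap_le_2: "1 \<le> n \<Longrightarrow> gap n \<le> 2"
  using gap_attained le_2 by metis

lemma m_pos: "1 \<le> n \<Longrightarrow> 0 < m n"
  unfolding m_def rational_pgf.mean_def[OF law]
  using rational_pgf.fin[OF law] nonempty rational_pgf.pos[OF law]
  by (intro sum_pos) auto

lemma m_at_top:
  assumes "filterlim (\<lambda>n. m n * gap n) at_top sequentially"
  shows "filterlim m at_top sequentially"
proof (rule filterlim_at_top_of_le_mult[OF assms, of 2])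
  fix n :: nat assume n: "1 \<le> n"
  have "m n * gap n \<le> m n * 2"
    using m_pos[OF n] gap_le_2[OF n] by (intro mult_left_mono) auto
  then show "m n * gap n \<le> 2 * m n" by simp
qed simp

lemma mean_iff_quantile:
  assumes "0 < \<epsilon>" "\<epsilon> < 1"
  shows "filterlim (\<lambda>n. m n * gap n) at_top sequentially
    \<longleftrightarrow> filterlim (\<lambda>n. real (q n \<epsilon>) * gap n) at_top sequentially"
proof
  assume "filterlim (\<lambda>n. m n * gap n) at_top sequentially"
  then show "filterlim (\<lambda>n. real (q n \<epsilon>) * gap n) at_top sequentially"
  proof (rule filterlim_at_top_of_le_mult)
    fix n :: nat assume n: "1 \<le> n"
    have "m n * gap n \<le> (3 / (1 - \<epsilon>) * real (q n \<epsilon>)) * gap n"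
      unfolding m_def q_def using rational_pgf.mean_le_quantile[OF law[OF n] assms] gap_pos[OF n]
      by (intro mult_right_mono) auto
    then show "m n * gap n \<le> 3 / (1 - \<epsilon>) * (real (q n \<epsilon>) * gap n)" by (simp only: mult.assoc)
  qed (use assms in simp)
next
  assume "filterlim (\<lambda>n. real (q n \<epsilon>) * gap n) at_top sequentially"
  then show "filterlim (\<lambda>n. m n * gap n) at_top sequentially"
  proof (rule filterlim_at_top_of_le_mult)
    fix n :: nat assume n: "1 \<le> n"
    have "real (q n \<epsilon>) * gap n \<le> (2 / \<epsilon> * m n) * gap n"
      unfolding m_def q_def using rational_pgf.quantile_le_mean[OF law[OF n] assms] gap_pos[OF n]
      by (intro mult_right_mono) auto
    then show "real (q n \<epsilon>) * gap n \<le> 2 / \<epsilon> * (m n * gap n)" by (simp only: mult.assoc)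
  qed (use assms in simp)
qed

text \<open>
  This is where the product of mean and gap enters: each \<open>1 / \<theta>\<^sub>i\<^sup>2\<close> is at most \<open>1 / \<theta>\<^sub>i\<close> divided
  by the smallest \<open>\<theta>\<close>.
\<close>
lemma var_le: "1 \<le> n \<Longrightarrow> v n \<le> m n / gap n"
proof -
  assume n: "1 \<le> n"
  have "(1 - \<theta> n i) / (\<theta> n i)\<^sup>2 \<le> 1 / \<theta> n i / gap n" if i: "i \<in> I n" for i
  proof -
    have t: "0 < \<theta> n i" by (rule rational_pgf.pos[OF law[OF n] i])
    have "(1 - \<theta> n i) / (\<theta> n i)\<^sup>2 \<le> 1 / (\<theta> n i)\<^sup>2"
      using t by (intro divide_right_mono) auto
    also have "\<dots> = 1 / \<theta> n i / \<theta> n i" by (simp add: power2_eq_square)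
    also have "\<dots> \<le> 1 / \<theta> n i / gap n"
      using t gap_le[OF n i] gap_pos[OF n] by (intro divide_left_mono) auto
    finally show ?thesis .
  qed
  then show ?thesis
    unfolding v_def m_def rational_pgf.var_def[OF law[OF n]] rational_pgf.mean_def[OF law[OF n]]
      sum_divide_distrib by (intro sum_mono) auto
qed

abbreviation b :: "nat \<Rightarrow> real" where "b n \<equiv> max (sqrt (v n)) 1"

lemma v_le_b: "v n \<le> (b n)\<^sup>2"
proof (cases "0 \<le> v n")
  case True
  then have "v n = (sqrt (v n))\<^sup>2" by simp
  also have "\<dots> \<le> (b n)\<^sup>2" using True by (intro power_mono) auto
  finally show ?thesis .
next
  case False
  then show ?thesis by (meson order.trans less_imp_le not_le zero_le_power2)
qed

lemma b_le: "1 \<le> n \<Longrightarrow> (b n)\<^sup>2 \<le> m n / gap n + 1"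
proof (cases "sqrt (v n) \<le> 1")
  case True
  assume n: "1 \<le> n"
  show ?thesis using True m_pos[OF n] gap_pos[OF n] by (simp add: max_absorb2)
next
  case False
  assume n: "1 \<le> n"
  from False have "0 \<le> v n" by (smt (verit) real_sqrt_lt_0_iff)
  then show ?thesis using False var_le[OF n] by (simp add: max_absorb1)
qed

lemma window_ratio:
  assumes "filterlim (\<lambda>n. m n * gap n) at_top sequentially"
  shows "(\<lambda>n. b n / m n) \<longlonglongrightarrow> 0"
proof (rule tendsto_sandwich)
  show "eventually (\<lambda>n. b n / m n \<le> sqrt (1 / (m n * gap n) + (1 / m n)\<^sup>2)) sequentially"
    using eventually_ge_at_top[of 1]
  proof eventually_elim
    case (elim n)
    have "(b n / m n)\<^sup>2 \<le> (m n / gap n + 1) / (m n)\<^sup>2"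
      unfolding power_divide using b_le[OF elim] by (rule divide_right_mono) simp
    also have "\<dots> = 1 / (m n * gap n) + (1 / m n)\<^sup>2"
      using m_pos[OF elim] gap_pos[OF elim] by (simp add: divide_simps power2_eq_square)
    finally show ?case by (rule real_le_rsqrt)
  qed
  show "eventually (\<lambda>n. 0 \<le> b n / m n) sequentially"
    using eventually_ge_at_top[of 1]
    by eventually_elim (use m_pos in \<open>simp add: le_max_iff_disj less_imp_le\<close>)
  have "(\<lambda>n. 1 / (m n * gap n)) \<longlonglongrightarrow> 0" "(\<lambda>n. 1 / m n) \<longlonglongrightarrow> 0"
    using assms m_at_top[OF assms]
    by (auto intro!: tendsto_divide_0[OF tendsto_const] filterlim_at_top_imp_at_infinity)
  then have "(\<lambda>n. sqrt (1 / (m n * gap n) + (1 / m n)\<^sup>2)) \<longlonglongrightarrow> sqrt (0 + 0\<^sup>2)"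
    by (intro tendsto_real_sqrt tendsto_add tendsto_power)
  then show "(\<lambda>n. sqrt (1 / (m n * gap n) + (1 / m n)\<^sup>2)) \<longlonglongrightarrow> 0" by simp
qed simp

lemma quantile_window:
  assumes "0 < \<epsilon>" "\<epsilon> < 1" "1 \<le> n"
  shows "\<bar>real (q n \<epsilon>) - m n\<bar> / b n \<le> 1 / sqrt \<epsilon> + 2 / sqrt (1 - \<epsilon>)"
proof -
  have "0 < b n" by (simp add: less_max_iff_disj)
  then show ?thesis
    using rational_pgf.quantile_window[OF law[OF assms(3)] assms(1,2) _ v_le_b[of n, unfolded v_def]]
    by (simp add: q_def m_def v_def pos_divide_le_eq)
qed

lemma quantile_ratio:
  assumes "filterlim (\<lambda>n. m n * gap n) at_top sequentially" "0 < \<epsilon>" "\<epsilon> < 1"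
  shows "(\<lambda>n. real (q n \<epsilon>) / m n) \<longlonglongrightarrow> 1"
proof -
  let ?C = "1 / sqrt \<epsilon> + 2 / sqrt (1 - \<epsilon>)"
  have "(\<lambda>n. real (q n \<epsilon>) / m n - 1) \<longlonglongrightarrow> 0"
  proof (rule tendsto_0_le[OF window_ratio[OF assms(1)]])
    show "eventually (\<lambda>n. norm (real (q n \<epsilon>) / m n - 1) \<le> norm (b n / m n) * ?C) sequentially"
      using eventually_ge_at_top[of 1]
    proof eventually_elim
      case (elim n)
      have b: "0 < b n" by (simp add: less_max_iff_disj)
      have "real (q n \<epsilon>) / m n - 1 = (real (q n \<epsilon>) - m n) / m n"
        using m_pos[OF elim] by (simp add: diff_divide_distrib)
      then have "norm (real (q n \<epsilon>) / m n - 1) = \<bar>real (q n \<epsilon>) - m n\<bar> / m n"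
        using m_pos[OF elim] by (simp add: abs_divide)
      also have "\<dots> \<le> (?C * b n) / m n"
        using quantile_window[OF assms(2,3) elim] b m_pos[OF elim]
        by (intro divide_right_mono) (auto simp only: pos_divide_le_eq less_imp_le)
      finally show ?case using b m_pos[OF elim] by (simp add: mult.commute)
    qed
  qed
  then show ?thesis by (simp add: LIM_zero_iff)
qed

text \<open>
  The quantiles at \<open>\<epsilon>\<close> and \<open>1 - \<epsilon>\<close> bound the transform from below and above up to an error \<open>\<epsilon>\<close>;
  all quantiles being asymptotic to \<open>t\<close>, both bounds tend to \<open>exp(-c)\<close> as \<open>\<epsilon>\<close> becomes small.
\<close>
lemma cutoff_imp_lap:
  assumes t: "\<And>n. 1 \<le> n \<Longrightarrow> 0 < t n" "filterlim t at_top sequentially"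
    and cut: "\<And>\<epsilon>. 0 < \<epsilon> \<Longrightarrow> \<epsilon> < 1 \<Longrightarrow> (\<lambda>n. real (q n \<epsilon>) / t n) \<longlonglongrightarrow> 1"
    and c: "0 < c"
  shows "(\<lambda>n. rational_pgf.lap (I n) (\<theta> n) (c / t n)) \<longlonglongrightarrow> exp (- c)"
    (is "?L \<longlonglongrightarrow> _")
proof (rule order_tendstoI)
  fix a assume a: "a < exp (- c)"
  define \<epsilon> where "\<epsilon> = min (1/2) ((exp (- c) - a) / 2)"
  have e: "0 < \<epsilon>" "\<epsilon> < 1" "\<epsilon> < exp (- c) - a" using a by (auto simp: \<epsilon>_def min_def)
  have "\<epsilon> * exp (- c) \<le> \<epsilon> * 1" using e c by (intro mult_left_mono) auto
  then have "a < (1 - \<epsilon>) * exp (- c)" unfolding left_diff_distrib using e by linarith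
  moreover have "(\<lambda>n. (1 - \<epsilon>) * (1 / (1 + c / t n)) ^ q n \<epsilon>) \<longlonglongrightarrow> (1 - \<epsilon>) * exp (- c)"
    by (intro tendsto_mult tendsto_const tendsto_geometric_exp t cut c e)
  ultimately have "eventually (\<lambda>n. a < (1 - \<epsilon>) * (1 / (1 + c / t n)) ^ q n \<epsilon>) sequentially"
    by (rule order_tendstoD(1)[rotated])
  with eventually_ge_at_top[of 1] show "eventually (\<lambda>n. a < ?L n) sequentially"
  proof eventually_elim
    case (elim n)
    then show ?case
      using rational_pgf.lap_ge_quantile[OF law e(1,2), of n "c / t n"] t(1)[of n] c
      by (simp add: q_def)
  qed
next
  fix a assume a: "exp (- c) < a"
  define \<epsilon> where "\<epsilon> = min (1/2) ((a - exp (- c)) / 2)"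
  have e: "0 < \<epsilon>" "\<epsilon> < 1" using a by (auto simp: \<epsilon>_def)
  have "\<epsilon> \<le> (a - exp (- c)) / 2" unfolding \<epsilon>_def by (rule min.cobounded2)
  then have close: "\<epsilon> + exp (- c) < a" using a by (simp add: field_simps)
  have "(\<lambda>n. \<epsilon> + (1 / (1 + c / t n)) ^ q n (1 - \<epsilon>)) \<longlonglongrightarrow> \<epsilon> + exp (- c)"
    by (intro tendsto_add tendsto_const tendsto_geometric_exp t cut c) (use e in auto)
  from order_tendstoD(2)[OF this close] eventually_ge_at_top[of 1]
  show "eventually (\<lambda>n. ?L n < a) sequentially"
  proof eventually_elim
    case (elim n)
    then show ?case
      using rational_pgf.lap_le_quantile[OF law e(1,2), of n "c / t n"] t(1)[of n] c
      by (simp add: q_def)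
  qed
qed

text \<open>
  The transform at \<open>c / t\<close> tends to \<open>exp(-c)\<close>, so the quotient of \<open>lap_ratio_ge\<close> at
  \<open>u = 1 / t\<close> tends to \<open>1\<close>. This rules out that a single \<open>\<theta>\<^sub>i\<close> contributes to \<open>T\<close> on the scale
  \<open>t\<close>.
\<close>
lemma cutoff_imp_gap:
  assumes t: "\<And>n. 1 \<le> n \<Longrightarrow> 0 < t n"
    and cut: "\<And>\<epsilon>. 0 < \<epsilon> \<Longrightarrow> \<epsilon> < 1 \<Longrightarrow> (\<lambda>n. real (q n \<epsilon>) / t n) \<longlonglongrightarrow> 1"
    and m: "filterlim m at_top sequentially"
  shows "filterlim (\<lambda>n. m n * gap n) at_top sequentially"
proof -
  have "filterlim (\<lambda>n. real (q n (1/2))) at_top sequentially"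
  proof (rule filterlim_at_top_of_le_mult[OF m, of 6])
    fix n :: nat assume n: "1 \<le> n"
    show "m n \<le> 6 * real (q n (1/2))"
      using rational_pgf.mean_le_quantile[OF law[OF n], of "1/2"] by (simp add: m_def q_def)
  qed simp
  moreover have "(\<lambda>n. inverse (real (q n (1/2)) / t n)) \<longlonglongrightarrow> inverse 1"
    by (intro tendsto_inverse cut) auto
  ultimately have "filterlim (\<lambda>n. inverse (real (q n (1/2)) / t n) * real (q n (1/2))) at_top sequentially"
    by (intro filterlim_tendsto_pos_mult_at_top[of _ 1]) auto
  moreover have "eventually (\<lambda>n. inverse (real (q n (1/2)) / t n) * real (q n (1/2)) = t n) sequentially"
    using eventually_ge_at_top[of 1]
  proof eventually_elim
    case (elim n)
    have "1 \<le> q n (1/2)"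
      unfolding q_def by (rule rational_pgf.quantile_pos[OF law[OF elim]]) auto
    then show ?case by simp
  qed
  ultimately have t_top: "filterlim t at_top sequentially"
    using filterlim_cong[OF refl refl] by fastforce
  let ?L = "\<lambda>c n. rational_pgf.lap (I n) (\<theta> n) (c / t n)"
  define a where "a n = 1 / (t n * gap n)" for n
  define y where "y n = (a n)\<^sup>2 / (1 + 2 * a n)" for n
  have a_pos: "0 < a n" if "1 \<le> n" for n using t[OF that] gap_pos[OF that] by (simp add: a_def)
  have "y \<longlonglongrightarrow> 0"
  proof (rule tendsto_sandwich)
    show "eventually (\<lambda>n. y n \<le> ?L 2 n / (?L 1 n)\<^sup>2 - 1) sequentially"
      using eventually_ge_at_top[of 1]
    proof eventually_elim
      case (elim n)
      obtain i where i: "i \<in> I n" "gap n = \<theta> n i" using gap_attained[OF elim] by auto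
      show ?case
        using rational_pgf.lap_ratio_ge[OF law[OF elim] _ i(1), of "1 / t n"] t[OF elim] i(2)
        by (simp add: y_def a_def)
    qed
    show "eventually (\<lambda>n. 0 \<le> y n) sequentially"
      using eventually_ge_at_top[of 1] by eventually_elim (use a_pos in \<open>simp add: y_def less_imp_le\<close>)
    have "(\<lambda>n. ?L 2 n / (?L 1 n)\<^sup>2 - 1) \<longlonglongrightarrow> exp (- 2) / (exp (- 1))\<^sup>2 - 1"
      by (intro tendsto_diff tendsto_divide tendsto_power tendsto_const cutoff_imp_lap t t_top cut) auto
    also have "exp (- 2) / (exp (- 1))\<^sup>2 - 1 = (0::real)"
      by (simp add: power2_eq_square exp_add[symmetric])
    finally show "(\<lambda>n. ?L 2 n / (?L 1 n)\<^sup>2 - 1) \<longlonglongrightarrow> 0" .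
  qed simp
  \<comment> \<open>The positive solution \<open>a\<close> of \<open>a\<^sup>2 = y (1 + 2 a)\<close> is a continuous function of \<open>y\<close>.\<close>
  then have "(\<lambda>n. y n + sqrt ((y n)\<^sup>2 + y n)) \<longlonglongrightarrow> 0 + sqrt (0\<^sup>2 + 0)"
    by (intro tendsto_add tendsto_real_sqrt tendsto_power)
  moreover have "eventually (\<lambda>n. y n + sqrt ((y n)\<^sup>2 + y n) = a n) sequentially"
    using eventually_ge_at_top[of 1]
  proof eventually_elim
    case (elim n)
    have p: "0 < 1 + 2 * a n" using a_pos[OF elim] by simp
    have "a n - y n = (a n + (a n)\<^sup>2) / (1 + 2 * a n)"
      using p by (simp add: y_def field_simps power2_eq_square)
    then have nn: "0 \<le> a n - y n" using a_pos[OF elim] p by simp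
    have "y n * (1 + 2 * a n) = (a n)\<^sup>2" using p by (simp add: y_def)
    then have "(y n)\<^sup>2 + y n = (a n - y n)\<^sup>2"
      by (simp add: power2_eq_square algebra_simps)
    then show ?case using nn by simp
  qed
  ultimately have "a \<longlonglongrightarrow> 0" by (auto elim: Lim_transform_eventually)
  moreover have "eventually (\<lambda>n. 0 < a n) sequentially"
    using eventually_ge_at_top[of 1] by eventually_elim (rule a_pos)
  ultimately have "filterlim (\<lambda>n. inverse (a n)) at_top sequentially"
    by (rule filterlim_inverse_at_top)
  moreover have "(\<lambda>n. real (q n (1/2)) / t n) \<longlonglongrightarrow> 1" by (rule cut) auto
  ultimately have "filterlim (\<lambda>n. real (q n (1/2)) / t n * inverse (a n)) at_top sequentially"
    by (intro filterlim_tendsto_pos_mult_at_top[of _ 1]) auto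
  moreover have "eventually (\<lambda>n. real (q n (1/2)) / t n * inverse (a n) = real (q n (1/2)) * gap n) sequentially"
    using eventually_ge_at_top[of 1] by eventually_elim (use t in \<open>force simp: a_def\<close>)
  ultimately have "filterlim (\<lambda>n. real (q n (1/2)) * gap n) at_top sequentially"
    using filterlim_cong[OF refl refl] by fastforce
  then show ?thesis using mean_iff_quantile[of "1/2"] by simp
qed

end

section \<open>Irreducible transition matrices and their stationary distribution\<close>

text \<open>
  In an integral domain a polynomial is divisible by the product of the linear factors of its
  roots, with multiplicities. Thus \<open>r\<close> non-zero real roots of the characteristic polynomial of
  \<open>I - P\<close>, together with the root \<open>0\<close>, determine it completely.
\<close>
lemma linear_factors_dvd:
  fixes p :: "'a :: idom poly"
  assumes "p \<noteq> 0" "M \<subseteq># proots p"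
  shows "(\<Prod>x\<in>#M. [:- x, 1:]) dvd p"
  using assms(2)
proof (induction M)
  case (add a M)
  let ?q = "\<Prod>x\<in>#M. [:- x, 1:]"
  have "M \<subseteq># proots p" using add.prems by (metis insert_subset_eq_iff mset_subset_eq_insertD subset_mset.less_imp_le)
  then obtain s where s: "p = ?q * s" using add.IH by blast
  have nz: "?q \<noteq> 0" "s \<noteq> 0" using assms(1) s by auto
  have "proots ?q = M"
  proof (induction M)
    case (add b M)
    have "(\<Prod>x\<in>#M. [:- x, 1:]) \<noteq> (0 :: 'a poly)" by (auto simp: prod_mset_zero_iff)
    then have "proots ([:- b, 1:] * (\<Prod>x\<in>#M. [:- x, 1:])) = proots [:- b, 1:] + proots (\<Prod>x\<in>#M. [:- x, 1:])"
      by (intro proots_mult) auto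
    then show ?case using add.IH by (simp del: mult_pCons_left)
  qed simp
  then have "proots p = M + proots s" using s nz by (simp add: proots_mult)
  then have "add_mset a M \<subseteq># M + proots s" using add.prems by simp
  then have "a \<in># proots s"
    by (metis add_mset_add_single mset_subset_eq_mono_add_left_cancel single_subset_iff)
  then have "poly s a = 0" using nz by simp
  then have "[:- a, 1:] dvd s" by (simp add: poly_eq_0_iff_dvd)
  then have "?q * [:- a, 1:] dvd ?q * s" by (intro mult_dvd_mono) auto
  then show ?case by (simp only: s image_mset_add_mset prod_mset.add_mset mult.commute[of "[:- a, 1:]"])
qed simp

lemma pow_mat_Suc_index:
  fixes P :: "real mat"
  assumes "P \<in> carrier_mat (Suc r) (Suc r)" "x \<le> r" "y \<le> r"
  shows "(P ^\<^sub>m Suc k) $$ (x, y) = (\<Sum>z\<le>r. (P ^\<^sub>m k) $$ (x, z) * P $$ (z, y))"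
  using assms by (simp add: scalar_prod_def atLeast0LessThan lessThan_Suc_atMost)

lemma pow_mat_Suc_index_left:
  fixes P :: "real mat"
  assumes "P \<in> carrier_mat (Suc r) (Suc r)" "x \<le> r" "y \<le> r"
  shows "(P ^\<^sub>m Suc k) $$ (x, y) = (\<Sum>z\<le>r. P $$ (x, z) * (P ^\<^sub>m k) $$ (z, y))"
proof -
  have "P ^\<^sub>m Suc k = P * P ^\<^sub>m k"
  proof (induction k)
    case (Suc k)
    have "P ^\<^sub>m k \<in> carrier_mat (Suc r) (Suc r)" using assms(1) by simp
    then show ?case using Suc assoc_mult_mat[OF assms(1) _ assms(1), of "P ^\<^sub>m k"] by simp
  qed (use assms(1) in simp)
  moreover have "P ^\<^sub>m k \<in> carrier_mat (Suc r) (Suc r)" using assms by simp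
  ultimately show ?thesis
    using assms by (simp add: scalar_prod_def atLeast0LessThan lessThan_Suc_atMost del: pow_mat.simps)
qed

lemma one_minus_mult_vec_index:
  fixes P :: "real mat"
  assumes "P \<in> carrier_mat (Suc r) (Suc r)" "f \<in> carrier_vec (Suc r)" "x \<le> r"
  shows "((1\<^sub>m (Suc r) - P) *\<^sub>v f) $ x = f $ x - (\<Sum>y\<le>r. P $$ (x, y) * f $ y)"
proof -
  have "((1\<^sub>m (Suc r) - P) *\<^sub>v f) $ x = (\<Sum>y\<le>r. ((if x = y then 1 else 0) - P $$ (x, y)) * f $ y)"
    using assms by (auto simp: scalar_prod_def atLeast0LessThan lessThan_Suc_atMost intro!: sum.cong)
  also have "\<dots> = (\<Sum>y\<le>r. (if x = y then f $ y else 0) - P $$ (x, y) * f $ y)"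
    by (intro sum.cong) (auto simp: algebra_simps)
  also have "\<dots> = f $ x - (\<Sum>y\<le>r. P $$ (x, y) * f $ y)"
    using assms by (simp add: sum_subtractf)
  finally show ?thesis .
qed

locale irreducible_chain =
  fixes r :: nat and P :: "real mat"
  assumes transition: "transition_matrix r P" and irreducible: "irreducible_mat r P"
begin

lemma carrier: "P \<in> carrier_mat (Suc r) (Suc r)"
  using transition by (simp add: transition_matrix_def)

lemma nonneg: "x \<le> r \<Longrightarrow> y \<le> r \<Longrightarrow> 0 \<le> P $$ (x, y)"
  using transition by (simp add: transition_matrix_def)

lemma row_sum: "x \<le> r \<Longrightarrow> (\<Sum>y\<le>r. P $$ (x, y)) = 1"
  using transition by (simp add: transition_matrix_def)

lemma pow_0: "x \<le> r \<Longrightarrow> y \<le> r \<Longrightarrow> (P ^\<^sub>m 0) $$ (x, y) = (if x = y then 1 else 0)"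
  using carrier by simp

lemmas pow_Suc = pow_mat_Suc_index[OF carrier]
lemmas pow_Suc_left = pow_mat_Suc_index_left[OF carrier]

lemma pow_nonneg: "x \<le> r \<Longrightarrow> y \<le> r \<Longrightarrow> 0 \<le> (P ^\<^sub>m k) $$ (x, y)"
proof (induction k arbitrary: y)
  case (Suc k)
  then show ?case by (auto simp: pow_Suc simp del: pow_mat.simps intro!: sum_nonneg mult_nonneg_nonneg nonneg)
qed (simp add: pow_0 del: pow_mat.simps)

lemma harmonic_pow:
  assumes "\<And>x. x \<le> r \<Longrightarrow> (\<Sum>y\<le>r. P $$ (x, y) * h y) = (h x :: real)" "x \<le> r"
  shows "(\<Sum>y\<le>r. (P ^\<^sub>m k) $$ (x, y) * h y) = h x"
proof (induction k)
  case 0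
  have "(\<Sum>y\<le>r. (P ^\<^sub>m 0) $$ (x, y) * h y) = (\<Sum>y\<le>r. if x = y then h y else 0)"
    using assms(2) by (intro sum.cong) (auto simp: pow_0 simp del: pow_mat.simps)
  then show ?case using assms(2) by simp
next
  case (Suc k)
  have "(\<Sum>y\<le>r. (P ^\<^sub>m Suc k) $$ (x, y) * h y)
      = (\<Sum>y\<le>r. \<Sum>z\<le>r. (P ^\<^sub>m k) $$ (x, z) * P $$ (z, y) * h y)"
    using assms(2) by (simp add: pow_Suc sum_distrib_right del: pow_mat.simps)
  also have "\<dots> = (\<Sum>z\<le>r. (P ^\<^sub>m k) $$ (x, z) * (\<Sum>y\<le>r. P $$ (z, y) * h y))"
    by (subst sum.swap) (simp add: sum_distrib_left mult.assoc)
  also have "\<dots> = (\<Sum>z\<le>r. (P ^\<^sub>m k) $$ (x, z) * h z)"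
    by (intro sum.cong) (auto simp: assms(1))
  finally show ?case using Suc by simp
qed

lemma pow_row_sum: "x \<le> r \<Longrightarrow> (\<Sum>y\<le>r. (P ^\<^sub>m k) $$ (x, y)) = 1"
  using harmonic_pow[of "\<lambda>_. 1" x k] row_sum by simp

lemma pow_le_1: "x \<le> r \<Longrightarrow> y \<le> r \<Longrightarrow> (P ^\<^sub>m k) $$ (x, y) \<le> 1"
  using member_le_sum[of y "{..r}" "\<lambda>y. (P ^\<^sub>m k) $$ (x, y)"] pow_nonneg pow_row_sum by simp

lemma invariant_pow:
  assumes "\<And>y. y \<le> r \<Longrightarrow> (\<Sum>x\<le>r. c x * P $$ (x, y)) = (c y :: real)" "y \<le> r"
  shows "(\<Sum>x\<le>r. c x * (P ^\<^sub>m k) $$ (x, y)) = c y"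
  using assms(2)
proof (induction k arbitrary: y)
  case 0
  have "(\<Sum>x\<le>r. c x * (P ^\<^sub>m 0) $$ (x, y)) = (\<Sum>x\<le>r. if x = y then c x else 0)"
    using 0 by (intro sum.cong) (auto simp: pow_0 simp del: pow_mat.simps)
  then show ?case using 0 by simp
next
  case (Suc k)
  have "(\<Sum>x\<le>r. c x * (P ^\<^sub>m Suc k) $$ (x, y))
      = (\<Sum>x\<le>r. \<Sum>z\<le>r. c x * (P ^\<^sub>m k) $$ (x, z) * P $$ (z, y))"
    using Suc.prems by (simp add: pow_Suc sum_distrib_left mult.assoc del: pow_mat.simps)
  also have "\<dots> = (\<Sum>z\<le>r. (\<Sum>x\<le>r. c x * (P ^\<^sub>m k) $$ (x, z)) * P $$ (z, y))"
    by (subst sum.swap) (simp add: sum_distrib_right)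
  also have "\<dots> = (\<Sum>z\<le>r. c z * P $$ (z, y))"
    by (intro sum.cong) (auto simp: Suc.IH)
  finally show ?case using assms(1) Suc.prems by simp
qed

text \<open>
  Maximum principle: at a point where \<open>h\<close> is maximal, \<open>h\<close> is an average, with respect to any power
  of \<open>P\<close>, of values that are not larger, and irreducibility makes every state count in one of
  these averages.
\<close>
lemma harmonic_const:
  assumes h: "\<And>x. x \<le> r \<Longrightarrow> (\<Sum>y\<le>r. P $$ (x, y) * h y) = (h x :: real)"
    and "x \<le> r" "y \<le> r"
  shows "h x = h y"
proof -
  obtain a where a: "a \<le> r" and max: "\<And>y. y \<le> r \<Longrightarrow> h y \<le> h a"
  proof -
    have "Max (h ` {..r}) \<in> h ` {..r}" by (intro Max_in) auto
    then obtain a where "Max (h ` {..r}) = h a" "a \<in> {..r}" by (rule imageE)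
    then show ?thesis using that by (metis Max_ge atMost_iff finite_atMost finite_imageI imageI)
  qed
  have "h y = h a" if y: "y \<le> r" for y
  proof -
    obtain k where k: "0 < (P ^\<^sub>m k) $$ (a, y)"
      using irreducible a y by (auto simp: irreducible_mat_def)
    have "(\<Sum>z\<le>r. (P ^\<^sub>m k) $$ (a, z) * (h a - h z)) = 0"
      using harmonic_pow[OF h a, of k] pow_row_sum[OF a, of k]
      by (simp add: right_diff_distrib sum_subtractf flip: sum_distrib_right)
    then have "\<forall>z\<in>{..r}. (P ^\<^sub>m k) $$ (a, z) * (h a - h z) = 0"
      by (subst (asm) sum_nonneg_eq_0_iff) (auto intro!: mult_nonneg_nonneg pow_nonneg simp: a max)
    then have "(P ^\<^sub>m k) $$ (a, y) * (h a - h y) = 0" using y by blast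
    then show ?thesis using k by simp
  qed
  then show ?thesis using assms by metis
qed

lemma invariant_pos:
  assumes c: "\<And>y. y \<le> r \<Longrightarrow> (\<Sum>x\<le>r. c x * P $$ (x, y)) = (c y :: real)"
    and "\<And>x. x \<le> r \<Longrightarrow> 0 \<le> c x" and "a \<le> r" "c a \<noteq> 0" and y: "y \<le> r"
  shows "0 < c y"
proof -
  obtain k where k: "0 < (P ^\<^sub>m k) $$ (a, y)"
    using irreducible assms(3) y unfolding irreducible_mat_def by blast
  have "0 < c a * (P ^\<^sub>m k) $$ (a, y)"
    using assms k by (simp add: less_le)
  also have "\<dots> \<le> (\<Sum>x\<le>r. c x * (P ^\<^sub>m k) $$ (x, y))"
    using assms pow_nonneg by (intro member_le_sum[of a "{..r}" "\<lambda>x. c x * (P ^\<^sub>m k) $$ (x, y)"]) auto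
  also have "\<dots> = c y" by (rule invariant_pow[OF c y])
  finally show ?thesis .
qed

text \<open>
  The triangle inequality gives \<open>\<bar>c\<bar> \<le> \<bar>c\<bar>P\<close>, and both sides have the same total since the rows of
  \<open>P\<close> sum to \<open>1\<close>.
\<close>
lemma invariant_abs:
  assumes c: "\<And>y. y \<le> r \<Longrightarrow> (\<Sum>x\<le>r. c x * P $$ (x, y)) = (c y :: real)" and y: "y \<le> r"
  shows "(\<Sum>x\<le>r. \<bar>c x\<bar> * P $$ (x, y)) = \<bar>c y\<bar>"
proof -
  have le: "\<bar>c y\<bar> \<le> (\<Sum>x\<le>r. \<bar>c x\<bar> * P $$ (x, y))" if "y \<le> r" for y
  proof -
    have "\<bar>c y\<bar> \<le> (\<Sum>x\<le>r. \<bar>c x * P $$ (x, y)\<bar>)"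
      by (subst c[OF that, symmetric]) (rule sum_abs)
    also have "\<dots> = (\<Sum>x\<le>r. \<bar>c x\<bar> * P $$ (x, y))"
      using nonneg that by (intro sum.cong) (auto simp: abs_mult)
    finally show ?thesis .
  qed
  have "(\<Sum>y\<le>r. \<Sum>x\<le>r. \<bar>c x\<bar> * P $$ (x, y)) = (\<Sum>x\<le>r. \<bar>c x\<bar> * (\<Sum>y\<le>r. P $$ (x, y)))"
    by (subst sum.swap) (simp add: sum_distrib_left)
  also have "\<dots> = (\<Sum>x\<le>r. \<bar>c x\<bar>)" by (intro sum.cong) (auto simp: row_sum)
  finally have "(\<Sum>y\<le>r. (\<Sum>x\<le>r. \<bar>c x\<bar> * P $$ (x, y)) - \<bar>c y\<bar>) = 0"
    by (simp add: sum_subtractf)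
  then have "\<forall>y\<in>{..r}. (\<Sum>x\<le>r. \<bar>c x\<bar> * P $$ (x, y)) - \<bar>c y\<bar> = 0"
    by (subst (asm) sum_nonneg_eq_0_iff) (auto simp: le)
  then show ?thesis using y by auto
qed

text \<open>
  The constants lie in the kernel of \<open>I - P\<close>, so its transpose is singular too.
\<close>
lemma ex_invariant: "\<exists>c. (\<forall>y\<le>r. (\<Sum>x\<le>r. c x * P $$ (x, y)) = (c y :: real)) \<and> (\<exists>x\<le>r. c x \<noteq> 0)"
proof -
  let ?A = "1\<^sub>m (Suc r) - P"
  have A: "?A \<in> carrier_mat (Suc r) (Suc r)" using carrier by (rule minus_carrier_mat)
  have "?A *\<^sub>v vec (Suc r) (\<lambda>_. 1) = 0\<^sub>v (Suc r)"
  proof (rule eq_vecI)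
    fix x assume "x < dim_vec (0\<^sub>v (Suc r) :: real vec)"
    then have "x \<le> r" by simp
    then show "(?A *\<^sub>v vec (Suc r) (\<lambda>_. 1)) $ x = 0\<^sub>v (Suc r) $ x"
      by (simp add: one_minus_mult_vec_index[OF carrier] row_sum)
  qed (use carrier in simp)
  moreover have "vec (Suc r) (\<lambda>_. 1 :: real) \<noteq> 0\<^sub>v (Suc r)"
    by (metis index_vec index_zero_vec(1) zero_less_Suc zero_neq_one)
  ultimately have "det ?A = 0"
    unfolding det_0_iff_vec_prod_zero_field[OF A] by (metis vec_carrier)
  then have "det ?A\<^sup>T = 0" by (simp add: det_transpose[OF A])
  then obtain v where v: "v \<in> carrier_vec (Suc r)" "v \<noteq> 0\<^sub>v (Suc r)" "?A\<^sup>T *\<^sub>v v = 0\<^sub>v (Suc r)"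
    using det_0_iff_vec_prod_zero_field[of "?A\<^sup>T" "Suc r"] A by auto
  have "(\<Sum>x\<le>r. v $ x * P $$ (x, y)) = v $ y" if y: "y \<le> r" for y
  proof -
    have "0 = (?A\<^sup>T *\<^sub>v v) $ y" using v y by simp
    also have "\<dots> = (\<Sum>x\<le>r. ((if x = y then 1 else 0) - P $$ (x, y)) * v $ x)"
      using carrier v(1) y
      by (auto simp: scalar_prod_def atLeast0LessThan lessThan_Suc_atMost intro!: sum.cong)
    also have "\<dots> = (\<Sum>x\<le>r. (if x = y then v $ x else 0) - v $ x * P $$ (x, y))"
      by (intro sum.cong) (auto simp: algebra_simps)
    also have "\<dots> = v $ y - (\<Sum>x\<le>r. v $ x * P $$ (x, y))" using y by (simp add: sum_subtractf)
    finally show ?thesis by simp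
  qed
  moreover have "\<exists>x\<le>r. v $ x \<noteq> 0"
  proof (rule ccontr)
    assume "\<not> ?thesis"
    then have "v = 0\<^sub>v (Suc r)" using v(1) by (intro eq_vecI) auto
    then show False using v by simp
  qed
  ultimately show ?thesis by blast
qed

lemma stationary_pos: "stationary r P \<mu> \<Longrightarrow> y \<le> r \<Longrightarrow> 0 < \<mu> $ y"
proof -
  assume s: "stationary r P \<mu>" and y: "y \<le> r"
  have "\<exists>a\<le>r. \<mu> $ a \<noteq> 0"
  proof (rule ccontr)
    assume "\<not> ?thesis"
    then have "(\<Sum>x\<le>r. \<mu> $ x) = 0" by simp
    then show False using s by (simp add: stationary_def)
  qed
  then show ?thesis using s y by (auto simp: stationary_def intro: invariant_pos[of "\<lambda>x. \<mu> $ x"])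
qed

lemma ex_stationary: "\<exists>\<mu>. stationary r P \<mu>"
proof -
  obtain c a where c: "\<And>y. y \<le> r \<Longrightarrow> (\<Sum>x\<le>r. c x * P $$ (x, y)) = (c y :: real)" and a: "a \<le> r" "c a \<noteq> 0"
    using ex_invariant by blast
  define s where "s = (\<Sum>x\<le>r. \<bar>c x\<bar>)"
  have "\<bar>c a\<bar> \<le> s" unfolding s_def using a by (intro member_le_sum) auto
  then have s: "0 < s" using a by linarith
  have "stationary r P (vec (Suc r) (\<lambda>x. \<bar>c x\<bar> / s))"
    unfolding stationary_def using s invariant_abs[OF c]
    by (auto simp: s_def simp flip: sum_divide_distrib)
  then show ?thesis by blast
qed

text \<open>
  The positive part of the difference of two stationary distributions is, up to a factor \<open>2\<close>,
  \<open>\<bar>d\<bar> + d\<close>, which is invariant. If it were non-zero it would be positive everywhere, and the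
  difference would have a positive sum.
\<close>
lemma stationary_unique:
  assumes "stationary r P \<mu>" "stationary r P \<nu>"
  shows "\<mu> = \<nu>"
proof -
  have le: "\<mu> $ y \<le> \<nu> $ y" if st: "stationary r P \<mu>" "stationary r P \<nu>" and y: "y \<le> r" for \<mu> \<nu> :: "real vec" and y
  proof (rule ccontr)
    assume neg: "\<not> ?thesis"
    define d where "d x = \<mu> $ x - \<nu> $ x" for x
    have inv: "(\<Sum>x\<le>r. d x * P $$ (x, y)) = d y" if "y \<le> r" for y
      using st that by (simp add: d_def stationary_def left_diff_distrib sum_subtractf)
    \<comment> \<open>Twice the positive part of \<open>d\<close>.\<close>
    define e where "e x = \<bar>d x\<bar> + d x" for x
    have "(\<Sum>x\<le>r. e x * P $$ (x, y)) = e y" if "y \<le> r" for y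
      using inv[OF that] invariant_abs[OF inv that] by (simp add: e_def distrib_right sum.distrib)
    moreover have "0 \<le> e x" for x by (simp add: e_def)
    moreover have "e y \<noteq> 0" using neg by (simp add: e_def d_def)
    ultimately have "0 < e x" if "x \<le> r" for x using invariant_pos[of e y x] y that by blast
    then have "0 < d x" if "x \<le> r" for x using that by (fastforce simp: e_def abs_if split: if_splits)
    then have "0 < (\<Sum>x\<le>r. d x)" by (intro sum_pos) auto
    also have "\<dots> = 0" using st by (simp add: d_def stationary_def sum_subtractf)
    finally show False by simp
  qed
  show ?thesis
  proof (rule eq_vecI)
    fix y assume "y < dim_vec \<nu>"
    then have "y \<le> r" using assms by (auto simp: stationary_def)
    then show "\<mu> $ y = \<nu> $ y" using le[OF assms] le[OF assms(2,1)] by (simp add: order.antisym)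
  qed (use assms in \<open>auto simp: stationary_def\<close>)
qed

abbreviation \<pi> :: "real vec" where "\<pi> \<equiv> stat r P"

lemma stationary_stat: "stationary r P \<pi>"
  unfolding stat_def using ex_stationary stationary_unique by (metis theI)

lemma stat_carrier: "\<pi> \<in> carrier_vec (Suc r)"
  and stat_sum: "(\<Sum>x\<le>r. \<pi> $ x) = 1"
  and stat_invariant: "y \<le> r \<Longrightarrow> (\<Sum>x\<le>r. \<pi> $ x * P $$ (x, y)) = \<pi> $ y"
  using stationary_stat by (auto simp: stationary_def)

lemma stat_pos: "x \<le> r \<Longrightarrow> 0 < \<pi> $ x"
  by (rule stationary_pos[OF stationary_stat])

text \<open>
  The densities \<open>g\<^sub>k(y) = P\<^sup>k(0, y) / \<pi>(y)\<close> evolve by the reversed chain, \<open>g\<^sub>k\<^sub>+\<^sub>1 = R g\<^sub>k\<close>. A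
  stochastically monotone kernel preserves non-increasing functions, as summation by parts shows,
  and \<open>g\<^sub>0\<close> is a multiple of the indicator of the smallest state. So the minimum of \<open>g\<^sub>k\<close> is at \<open>r\<close>;
  averages of \<open>g\<^sub>k\<close> are at least \<open>g\<^sub>k(r)\<close>, which yields the other two claims.
\<close>
lemma sep_monotone:
  assumes mono: "stochastically_monotone r (time_reversal r P)"
  defines "F \<equiv> \<lambda>k. (P ^\<^sub>m k) $$ (0, r) / \<pi> $ r"
  shows "sep r P k 0 = 1 - F k" and "F k \<le> F (Suc k)" and "F k \<le> 1"
proof -
  define R where "R y z = \<pi> $ z * P $$ (z, y) / \<pi> $ y" for y z
  define g where "g k y = (P ^\<^sub>m k) $$ (0, y) / \<pi> $ y" for k y
  have R_nonneg: "0 \<le> R y z" if "y \<le> r" "z \<le> r" for y z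
    using stat_pos that nonneg by (simp add: R_def less_imp_le)
  have R_sum: "(\<Sum>z\<le>r. R y z) = 1" if "y \<le> r" for y
    using stat_invariant[OF that] stat_pos[OF that] by (simp add: R_def flip: sum_divide_distrib)
  have R_mono: "(\<Sum>z\<le>x. R y' z) \<le> (\<Sum>z\<le>x. R y z)" if "x \<le> r" "y \<le> y'" "y' \<le> r" for x y y'
    using mono that unfolding stochastically_monotone_def time_reversal_def
    by (simp add: R_def)
  have g_Suc: "g (Suc k) y = (\<Sum>z\<le>r. R y z * g k z)" if "y \<le> r" for k y
  proof -
    have "(P ^\<^sub>m k) $$ (0, z) * P $$ (z, y) / \<pi> $ y = R y z * g k z" if "z \<le> r" for z
      using stat_pos[OF that] by (simp add: R_def g_def)
    then show ?thesis using that
      by (simp add: g_def[of "Suc k"] pow_Suc sum_divide_distrib del: pow_mat.simps)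
  qed
  \<comment> \<open>Summation by parts writes a non-increasing \<open>h\<close> through the sums of \<open>w\<close> over initial segments,
    which is what stochastic monotonicity compares.\<close>
  have abel: "(\<Sum>z\<le>n. w z * h z) = (\<Sum>z\<le>n. w z) * h n + (\<Sum>x<n. (h x - h (Suc x)) * (\<Sum>z\<le>x. w z))"
    for w h :: "nat \<Rightarrow> real" and n
    by (induction n) (simp_all add: algebra_simps)
  have g_anti: "g k y' \<le> g k y" if "y \<le> y'" "y' \<le> r" for k y y'
    using that
  proof (induction k arbitrary: y y')
    case 0
    then show ?case using stat_pos[of 0] by (auto simp: g_def pow_0 simp del: pow_mat.simps)
  next
    case (Suc k)
    have "(\<Sum>x<r. (g k x - g k (Suc x)) * (\<Sum>z\<le>x. R y' z))
        \<le> (\<Sum>x<r. (g k x - g k (Suc x)) * (\<Sum>z\<le>x. R y z))"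
      using Suc by (intro sum_mono mult_left_mono R_mono) auto
    then show ?case
      using Suc.prems by (simp add: g_Suc abel[of _ "g k"] R_sum)
  qed
  have F: "F k = g k r" for k by (simp add: F_def g_def)
  have "F k = (\<Sum>z\<le>r. R r z * F k)" by (simp add: R_sum flip: sum_distrib_right)
  also have "\<dots> \<le> (\<Sum>z\<le>r. R r z * g k z)"
    unfolding F by (intro sum_mono mult_left_mono g_anti R_nonneg) auto
  finally show "F k \<le> F (Suc k)" by (simp add: F g_Suc)
  have "F k = (\<Sum>y\<le>r. \<pi> $ y * F k)" by (simp add: stat_sum flip: sum_distrib_right)
  also have "\<dots> \<le> (\<Sum>y\<le>r. \<pi> $ y * g k y)"
    unfolding F by (intro sum_mono mult_left_mono g_anti) (auto intro: less_imp_le stat_pos)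
  also have "\<dots> = (\<Sum>y\<le>r. (P ^\<^sub>m k) $$ (0, y))"
    by (intro sum.cong) (auto simp: g_def dest: stat_pos)
  finally show "F k \<le> 1" by (simp add: pow_row_sum)
  show "sep r P k 0 = 1 - F k"
    unfolding sep_def
  proof (rule Max_eqI)
    show "1 - F k \<in> (\<lambda>y. 1 - (P ^\<^sub>m k) $$ (0, y) / \<pi> $ y) ` {0..r}" by (auto simp: F_def)
    fix s assume "s \<in> (\<lambda>y. 1 - (P ^\<^sub>m k) $$ (0, y) / \<pi> $ y) ` {0..r}"
    then show "s \<le> 1 - F k" using g_anti[of _ r k] by (auto simp: F_def g_def)
  qed simp
qed

end

section \<open>Orthonormal bases of the centred functions\<close>

lemma l2_inner_eq: "\<mu> \<in> carrier_vec (Suc r) \<Longrightarrow> l2_inner \<mu> f g = (\<Sum>x\<le>r. f $ x * g $ x * \<mu> $ x)"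
  by (auto simp: l2_inner_def lessThan_Suc_atMost)

lemma l2_centred_iff:
  "\<mu> \<in> carrier_vec (Suc r) \<Longrightarrow>
    f \<in> l2_centred \<mu> \<longleftrightarrow> f \<in> carrier_vec (Suc r) \<and> (\<Sum>x\<le>r. f $ x * \<mu> $ x) = 0"
  by (auto simp: l2_centred_def l2_inner_eq[of _ r])

text \<open>
  Bessel's inequality for the indicator of \<open>x\<close> bounds the sum of all \<open>e(x)\<^sup>2 \<mu>(x)\<close> by \<open>1\<close>; summing
  over \<open>x\<close> counts the elements of \<open>B\<close>.
\<close>
lemma orthonormal_card_le:
  assumes \<mu>: "\<mu> \<in> carrier_vec (Suc r)" and pos: "\<And>x. x \<le> r \<Longrightarrow> 0 < \<mu> $ x"
    and "finite B" and on: "\<And>e e'. e \<in> B \<Longrightarrow> e' \<in> B \<Longrightarrow> l2_inner \<mu> e e' = (if e = e' then 1 else 0)"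
  shows "card B \<le> Suc r"
proof -
  have bessel: "(\<Sum>e\<in>B. (e $ x)\<^sup>2) * \<mu> $ x \<le> 1" if x: "x \<le> r" for x
  proof -
    define S where "S = (\<Sum>e\<in>B. (e $ x)\<^sup>2)"
    define s where "s y = (\<Sum>e\<in>B. e $ x * e $ y)" for y
    define d where "d y = (if x = y then 1 else 0 :: real)" for y
    have 1: "(\<Sum>y\<le>r. d y * d y * \<mu> $ y) = \<mu> $ x"
      using x by (simp add: d_def if_distrib[of "\<lambda>t. t * _"] cong: if_cong)
    have 2: "(\<Sum>y\<le>r. d y * s y * \<mu> $ y) = S * \<mu> $ x"
      using x by (simp add: d_def s_def S_def power2_eq_square if_distrib[of "\<lambda>t. t * _"] cong: if_cong)
    have 3: "(\<Sum>y\<le>r. s y * s y * \<mu> $ y) = S"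
    proof -
      have "(\<Sum>y\<le>r. s y * s y * \<mu> $ y)
          = (\<Sum>y\<le>r. \<Sum>e\<in>B. \<Sum>e'\<in>B. e $ x * e' $ x * (e $ y * e' $ y * \<mu> $ y))"
      proof (intro sum.cong refl)
        fix y
        have "s y * s y * \<mu> $ y = (\<Sum>e\<in>B. \<Sum>e'\<in>B. (e $ x * e $ y) * (e' $ x * e' $ y) * \<mu> $ y)"
          unfolding s_def sum_product by (simp only: sum_distrib_right)
        then show "s y * s y * \<mu> $ y = (\<Sum>e\<in>B. \<Sum>e'\<in>B. e $ x * e' $ x * (e $ y * e' $ y * \<mu> $ y))"
          by (simp add: mult_ac)
      qed
      also have "\<dots> = (\<Sum>e\<in>B. \<Sum>e'\<in>B. \<Sum>y\<le>r. e $ x * e' $ x * (e $ y * e' $ y * \<mu> $ y))"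
        by (subst sum.swap, intro sum.cong refl sum.swap)
      also have "\<dots> = (\<Sum>e\<in>B. \<Sum>e'\<in>B. e $ x * e' $ x * l2_inner \<mu> e e')"
        by (simp add: l2_inner_eq[OF \<mu>] sum_distrib_left)
      also have "\<dots> = (\<Sum>e\<in>B. \<Sum>e'\<in>B. if e = e' then (e $ x)\<^sup>2 else 0)"
        by (intro sum.cong refl) (auto simp: on power2_eq_square)
      also have "\<dots> = S" using assms(3) by (simp add: S_def)
      finally show ?thesis .
    qed
    have "0 \<le> (\<Sum>y\<le>r. (d y - \<mu> $ x * s y)\<^sup>2 * \<mu> $ y)"
      using pos by (intro sum_nonneg mult_nonneg_nonneg) (auto intro: less_imp_le)
    also have "\<dots> = (\<Sum>y\<le>r. d y * d y * \<mu> $ y) - 2 * \<mu> $ x * (\<Sum>y\<le>r. d y * s y * \<mu> $ y)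
        + (\<mu> $ x)\<^sup>2 * (\<Sum>y\<le>r. s y * s y * \<mu> $ y)"
      by (simp add: sum_distrib_left flip: sum_subtractf sum.distrib)
        (intro sum.cong refl, simp add: power2_eq_square algebra_simps)
    also have "\<dots> = \<mu> $ x * (1 - S * \<mu> $ x)"
      unfolding 1 2 3 by (simp add: power2_eq_square algebra_simps)
    finally show ?thesis using pos[OF x] by (simp add: S_def zero_le_mult_iff)
  qed
  have "real (card B) = (\<Sum>e\<in>B. l2_inner \<mu> e e)" by (simp add: on)
  also have "\<dots> = (\<Sum>x\<le>r. (\<Sum>e\<in>B. (e $ x)\<^sup>2) * \<mu> $ x)"
    unfolding l2_inner_eq[OF \<mu>]
    by (subst sum.swap) (simp add: sum_distrib_right power2_eq_square)
  also have "\<dots> \<le> (\<Sum>x\<le>r. 1)" by (intro sum_mono bessel) auto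
  finally show ?thesis by simp
qed

text \<open>
  An orthonormal set of maximal size is complete: a non-zero function orthogonal to it could be
  normalised and added.
\<close>
lemma ex_orthonormal_basis:
  assumes \<mu>: "\<mu> \<in> carrier_vec (Suc r)" and pos: "\<And>x. x \<le> r \<Longrightarrow> 0 < \<mu> $ x"
  shows "\<exists>B. orthonormal_basis \<mu> (l2_centred \<mu>) B"
proof -
  define ON where "ON B \<longleftrightarrow> finite B \<and> B \<subseteq> l2_centred \<mu> \<and>
    (\<forall>e\<in>B. \<forall>e'\<in>B. l2_inner \<mu> e e' = (if e = e' then 1 else 0))" for B
  have "ON {}" by (simp add: ON_def)
  moreover have "\<forall>B. ON B \<longrightarrow> card B < Suc (Suc r)"
    using orthonormal_card_le[OF \<mu> pos] by (auto simp: ON_def less_Suc_eq_le)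
  ultimately obtain B where B: "ON B" and max: "\<And>B'. ON B' \<Longrightarrow> card B' \<le> card B"
    using ex_has_greatest_nat[of ON "{}" card] by blast
  have "f = 0\<^sub>v (Suc r)" if f: "f \<in> l2_centred \<mu>" and orth: "\<And>e. e \<in> B \<Longrightarrow> l2_inner \<mu> f e = 0" for f
  proof (rule ccontr)
    assume nz: "f \<noteq> 0\<^sub>v (Suc r)"
    have fc: "f \<in> carrier_vec (Suc r)" "(\<Sum>x\<le>r. f $ x * \<mu> $ x) = 0"
      using f by (auto simp: l2_centred_iff[OF \<mu>])
    obtain a where a: "a \<le> r" "f $ a \<noteq> 0"
    proof (rule ccontr)
      assume "\<not> thesis"
      then have "f $ x = 0" if "x \<le> r" for x using \<open>\<And>a. \<lbrakk>a \<le> r; f $ a \<noteq> 0\<rbrakk> \<Longrightarrow> thesis\<close> that by blast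
      then have "f = 0\<^sub>v (Suc r)" using fc by (intro eq_vecI) auto
      then show False using nz by simp
    qed
    \<comment> \<open>The squared norm of \<open>f\<close> is positive, since \<open>\<mu>\<close> is positive at \<open>a\<close>.\<close>
    define n where "n = l2_inner \<mu> f f"
    have fa: "0 < f $ a * f $ a * \<mu> $ a" using a pos by (auto simp: zero_less_mult_iff)
    have nn: "0 \<le> f $ x * f $ x * \<mu> $ x" if "x \<le> r" for x
      by (intro mult_nonneg_nonneg[OF zero_le_square] less_imp_le[OF pos[OF that]])
    have "f $ a * f $ a * \<mu> $ a \<le> n"
      unfolding n_def l2_inner_eq[OF \<mu>] using a pos
      by (intro member_le_sum[of a "{..r}" "\<lambda>x. f $ x * f $ x * \<mu> $ x"])
        (auto simp: nn)
    with fa have n: "0 < n" by linarith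
    define g where "g = (1 / sqrt n) \<cdot>\<^sub>v f"
    have g: "g $ x = f $ x / sqrt n" if "x \<le> r" for x using fc that by (simp add: g_def)
    have gc: "g \<in> l2_centred \<mu>"
      using fc by (auto simp: l2_centred_iff[OF \<mu>] g_def simp flip: sum_divide_distrib)
    have gg: "l2_inner \<mu> g g = 1"
    proof -
      have "l2_inner \<mu> g g = l2_inner \<mu> f f / (sqrt n * sqrt n)"
        unfolding l2_inner_eq[OF \<mu>] sum_divide_distrib by (intro sum.cong) (auto simp: g)
      then show ?thesis using n by (simp add: n_def)
    qed
    have ge: "l2_inner \<mu> g e = 0" if "e \<in> B" for e
    proof -
      have "l2_inner \<mu> g e = l2_inner \<mu> f e / sqrt n"
        unfolding l2_inner_eq[OF \<mu>] sum_divide_distrib by (intro sum.cong) (auto simp: g)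
      then show ?thesis using orth[OF that] by simp
    qed
    have eg: "l2_inner \<mu> e g = 0" if "e \<in> B" for e
      using ge[OF that] by (simp add: l2_inner_def mult_ac)
    have "g \<notin> B" using ge gg by force
    moreover from this have "ON (insert g B)"
      using B gc gg ge eg by (auto simp: ON_def)
    ultimately have "card (insert g B) = Suc (card B)" "card (insert g B) \<le> card B"
      using B max[of "insert g B"] by (simp_all add: ON_def)
    then show False by simp
  qed
  then have "orthonormal_basis \<mu> (l2_centred \<mu>) B"
    using B \<mu> by (auto simp: ON_def orthonormal_basis_def)
  then show ?thesis by blast
qed

text \<open>
  The elements of \<open>B\<close> together with the constant function \<open>1\<close> resolve the identity. It suffices
  that the difference of the two sides, as a function of \<open>x\<close>, is centred and orthogonal to \<open>B\<close>.
  With this formula the trace of an operator in the basis \<open>B\<close> becomes a sum over matrix entries.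
\<close>
lemma orthonormal_basis_resolution:
  assumes \<mu>: "\<mu> \<in> carrier_vec (Suc r)" and total: "(\<Sum>x\<le>r. \<mu> $ x) = 1"
    and B: "orthonormal_basis \<mu> (l2_centred \<mu>) B" and x: "x \<le> r" and y: "y \<le> r"
  shows "(\<Sum>e\<in>B. e $ x * e $ y * \<mu> $ y) = (if x = y then 1 else 0) - \<mu> $ y"
proof -
  define f where "f = vec (Suc r) (\<lambda>x. (if x = y then 1 else 0) - \<mu> $ y - (\<Sum>e\<in>B. e $ y * \<mu> $ y * e $ x))"
  have fin: "finite B" using B by (simp add: orthonormal_basis_def)
  have centred: "(\<Sum>x\<le>r. e $ x * \<mu> $ x) = 0" if "e \<in> B" for e
    using B that l2_centred_iff[OF \<mu>] by (auto simp: orthonormal_basis_def)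
  have pair: "(\<Sum>x\<le>r. f $ x * g x * \<mu> $ x)
      = g y * \<mu> $ y - \<mu> $ y * (\<Sum>x\<le>r. g x * \<mu> $ x)
        - (\<Sum>e\<in>B. e $ y * \<mu> $ y * (\<Sum>x\<le>r. e $ x * g x * \<mu> $ x))" for g :: "nat \<Rightarrow> real"
  proof -
    have "(\<Sum>x\<le>r. f $ x * g x * \<mu> $ x) = (\<Sum>x\<le>r. (if x = y then g x * \<mu> $ x else 0)
        - \<mu> $ y * (g x * \<mu> $ x) - (\<Sum>e\<in>B. e $ y * \<mu> $ y * (e $ x * g x * \<mu> $ x)))"
    proof (intro sum.cong refl)
      fix x assume "x \<in> {..r}"
      then have "f $ x * g x * \<mu> $ x = ((if x = y then 1 else 0) - \<mu> $ y) * (g x * \<mu> $ x)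
          - (\<Sum>e\<in>B. e $ y * \<mu> $ y * e $ x) * (g x * \<mu> $ x)"
        by (simp add: f_def algebra_simps)
      moreover have "(\<Sum>e\<in>B. e $ y * \<mu> $ y * e $ x) * (g x * \<mu> $ x)
          = (\<Sum>e\<in>B. e $ y * \<mu> $ y * (e $ x * g x * \<mu> $ x))"
        unfolding sum_distrib_right by (intro sum.cong refl) (simp add: mult_ac)
      ultimately show "f $ x * g x * \<mu> $ x = (if x = y then g x * \<mu> $ x else 0)
        - \<mu> $ y * (g x * \<mu> $ x) - (\<Sum>e\<in>B. e $ y * \<mu> $ y * (e $ x * g x * \<mu> $ x))"
        by (auto simp: left_diff_distrib)
    qed
    also have "\<dots> = g y * \<mu> $ y - (\<Sum>x\<le>r. \<mu> $ y * (g x * \<mu> $ x))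
        - (\<Sum>x\<le>r. \<Sum>e\<in>B. e $ y * \<mu> $ y * (e $ x * g x * \<mu> $ x))"
      using y by (simp add: sum_subtractf)
    also have "(\<Sum>x\<le>r. \<Sum>e\<in>B. e $ y * \<mu> $ y * (e $ x * g x * \<mu> $ x))
        = (\<Sum>e\<in>B. \<Sum>x\<le>r. e $ y * \<mu> $ y * (e $ x * g x * \<mu> $ x))"
      by (rule sum.swap)
    finally show ?thesis by (simp only: sum_distrib_left)
  qed
  have "f \<in> l2_centred \<mu>"
    using pair[of "\<lambda>_. 1"] by (simp add: l2_centred_iff[OF \<mu>] f_def total centred)
  moreover have "l2_inner \<mu> f e' = 0" if e': "e' \<in> B" for e'
  proof -
    have "l2_inner \<mu> f e' = e' $ y * \<mu> $ y - \<mu> $ y * 0 - (\<Sum>e\<in>B. e $ y * \<mu> $ y * l2_inner \<mu> e e')"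
      unfolding l2_inner_eq[OF \<mu>] using pair[of "\<lambda>x. e' $ x"] centred[OF e'] by simp
    also have "(\<Sum>e\<in>B. e $ y * \<mu> $ y * l2_inner \<mu> e e')
        = (\<Sum>e\<in>B. if e = e' then e $ y * \<mu> $ y else 0)"
      using B e' by (intro sum.cong) (auto simp: orthonormal_basis_def)
    also have "\<dots> = e' $ y * \<mu> $ y" using fin e' by simp
    finally show ?thesis by simp
  qed
  ultimately have "f = 0\<^sub>v (Suc r)" using B \<mu> by (auto simp: orthonormal_basis_def)
  then have "f $ x = 0" using x by simp
  then show ?thesis using x by (simp add: f_def mult_ac)
qed

section \<open>The adjugate of the characteristic matrix\<close>

lemma const_poly_sum: "[:sum f A:] = (\<Sum>x\<in>A. [:f x:])"
  by (rule poly_eqI) (simp add: coeff_sum coeff_pCons split: nat.split)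

lemma prod_linear_factors_coeffs:
  fixes \<theta> :: "'i \<Rightarrow> real"
  assumes "finite I" "\<And>i. i \<in> I \<Longrightarrow> \<theta> i \<noteq> 0"
  shows "coeff (\<Prod>i\<in>I. [:- \<theta> i, 1:]) 1 = - (\<Sum>i\<in>I. 1 / \<theta> i) * coeff (\<Prod>i\<in>I. [:- \<theta> i, 1:]) 0"
  using assms
proof (induction I)
  case (insert j I)
  then show ?case by (simp add: field_simps)
qed simp

locale spectral_chain = irreducible_chain +
  fixes \<theta> :: "nat \<Rightarrow> real"
  assumes eigenvalues: "nonzero_eigenvalues r P \<theta>"
    and up: "\<And>x. x < r \<Longrightarrow> 0 < P $$ (x, Suc x)"
    and skip_free: "\<And>x y. x + 2 \<le> y \<Longrightarrow> y \<le> r \<Longrightarrow> P $$ (x, y) = 0"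
begin

abbreviation L :: "real mat" where "L \<equiv> 1\<^sub>m (Suc r) - P"

text \<open>
  The characteristic polynomial of \<open>I - P\<close> without its root \<open>0\<close> (\<open>char_poly_L\<close>).
\<close>
definition \<psi> :: "real poly" where "\<psi> = (\<Prod>i\<in>{1..r}. [:- \<theta> i, 1:])"

lemma L_carrier: "L \<in> carrier_mat (Suc r) (Suc r)"
  using carrier by (rule minus_carrier_mat)

lemma L_eigenvalue_iff: "poly (char_poly L) k = 0 \<longleftrightarrow>
    (\<exists>v \<in> carrier_vec (Suc r). v \<noteq> 0\<^sub>v (Suc r) \<and> (\<forall>x\<le>r. v $ x - (\<Sum>y\<le>r. P $$ (x, y) * v $ y) = k * v $ x))"
proof -
  have "L *\<^sub>v v = k \<cdot>\<^sub>v v \<longleftrightarrow> (\<forall>x\<le>r. v $ x - (\<Sum>y\<le>r. P $$ (x, y) * v $ y) = k * v $ x)"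
    if v: "v \<in> carrier_vec (Suc r)" for v
  proof
    assume eq: "L *\<^sub>v v = k \<cdot>\<^sub>v v"
    show "\<forall>x\<le>r. v $ x - (\<Sum>y\<le>r. P $$ (x, y) * v $ y) = k * v $ x"
    proof (intro allI impI)
      fix x assume x: "x \<le> r"
      have "(L *\<^sub>v v) $ x = (k \<cdot>\<^sub>v v) $ x" by (simp only: eq)
      also have "\<dots> = k * v $ x" using v x by simp
      finally show "v $ x - (\<Sum>y\<le>r. P $$ (x, y) * v $ y) = k * v $ x"
        by (simp only: one_minus_mult_vec_index[OF carrier v x])
    qed
  next
    assume eq: "\<forall>x\<le>r. v $ x - (\<Sum>y\<le>r. P $$ (x, y) * v $ y) = k * v $ x"
    show "L *\<^sub>v v = k \<cdot>\<^sub>v v"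
    proof (rule eq_vecI)
      fix x assume "x < dim_vec (k \<cdot>\<^sub>v v)"
      then have x: "x \<le> r" using v by auto
      then show "(L *\<^sub>v v) $ x = (k \<cdot>\<^sub>v v) $ x"
        unfolding one_minus_mult_vec_index[OF carrier v x] using eq v by simp
    qed (use L_carrier v in auto)
  qed
  then show ?thesis
    unfolding eigenvalue_root_char_poly[OF L_carrier, symmetric] eigenvalue_def eigenvector_def
    using carrier by auto
qed

text \<open>
  The \<open>r\<close> non-zero roots \<open>\<theta>\<^sub>i\<close> and the root \<open>0\<close>, whose eigenvector is constant, already account for
  the degree \<open>r + 1\<close>. In particular \<open>0\<close> is a simple root.
\<close>
lemma char_poly_L: "char_poly L = [:0, 1:] * \<psi>"
proof -
  let ?\<chi> = "char_poly L"
  let ?M = "add_mset 0 (image_mset \<theta> (mset_set {1..r}))"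
  have deg: "degree ?\<chi> = Suc r" "lead_coeff ?\<chi> = 1"
    using degree_monic_char_poly[OF L_carrier] by auto
  then have nz: "?\<chi> \<noteq> 0" by auto
  have "poly ?\<chi> 0 = 0"
    unfolding L_eigenvalue_iff
  proof (intro bexI conjI allI impI)
    show "vec (Suc r) (\<lambda>_. 1 :: real) \<noteq> 0\<^sub>v (Suc r)"
      by (metis index_vec index_zero_vec(1) zero_less_Suc zero_neq_one)
  qed (auto simp: row_sum)
  then have zero: "0 \<in># proots ?\<chi>" using nz by simp
  have eig: "image_mset \<theta> (mset_set {1..r}) = filter_mset (\<lambda>z. z \<noteq> 0) (proots ?\<chi>)"
    using eigenvalues by (simp add: nonzero_eigenvalues_def)
  have "?M \<subseteq># proots ?\<chi>"
  proof (rule mset_subset_eqI)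
    fix z
    show "count ?M z \<le> count (proots ?\<chi>) z"
      unfolding eig using zero
      by (cases "z = 0") (auto simp: Suc_le_eq simp del: count_proots simp flip: count_greater_zero_iff)
  qed
  from linear_factors_dvd[OF nz this]
  have dvd: "[:0, 1:] * \<psi> dvd ?\<chi>"
    by (simp add: \<psi>_def prod_unfold_prod_mset image_mset.compositionality comp_def)
  have degp: "degree ([:0, 1:] * \<psi>) = Suc r" "lead_coeff ([:0, 1:] * \<psi>) = 1"
  proof -
    have nz: "\<psi> \<noteq> 0" by (simp add: \<psi>_def)
    have "degree \<psi> = r" unfolding \<psi>_def by (subst degree_prod_eq_sum_degree) auto
    moreover have "lead_coeff \<psi> = 1" unfolding \<psi>_def lead_coeff_prod by simp
    ultimately show "degree ([:0, 1:] * \<psi>) = Suc r" "lead_coeff ([:0, 1:] * \<psi>) = 1"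
      using nz by (auto simp: degree_mult_eq lead_coeff_mult)
  qed
  from dvd obtain s where s: "?\<chi> = [:0, 1:] * \<psi> * s" by (elim dvdE)
  have "s \<noteq> 0" "[:0, 1:] * \<psi> \<noteq> 0" using s nz by auto
  then have "degree ?\<chi> = degree ([:0, 1:] * \<psi>) + degree s"
    unfolding s by (intro degree_mult_eq)
  then have "degree s = 0" by (simp only: deg(1) degp(1))
  then obtain c where c: "s = [:c:]" by (auto elim: degree_eq_zeroE)
  have "lead_coeff ?\<chi> = lead_coeff ([:0, 1:] * \<psi>) * lead_coeff s"
    unfolding s by (rule lead_coeff_mult)
  then have "lead_coeff s = 1" by (simp only: deg(2) degp(2))
  then have "s = 1" by (simp add: c one_pCons)
  then show ?thesis unfolding s by (simp only: mult_1_right)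
qed

text \<open>
  As \<open>1 - \<theta>\<^sub>i\<close> is an eigenvalue of a stochastic matrix, its modulus is at most \<open>1\<close>.
\<close>
lemma theta_bounds:
  assumes i: "i \<in> {1..r}"
  shows "0 < \<theta> i" and "\<theta> i \<le> 2"
proof -
  have "\<theta> i \<in># image_mset \<theta> (mset_set {1..r})" using i by simp
  then have "\<theta> i \<in># filter_mset (\<lambda>z. z \<noteq> 0) (proots (char_poly L))"
    by (simp only: eigenvalues[unfolded nonzero_eigenvalues_def])
  then have nz: "\<theta> i \<noteq> 0" and root: "\<theta> i \<in># proots (char_poly L)"
    by auto
  have "char_poly L \<noteq> 0" using degree_monic_char_poly[OF L_carrier] by auto
  then have "poly (char_poly L) (\<theta> i) = 0" using root by simp
  then obtain v where v: "v \<in> carrier_vec (Suc r)" "v \<noteq> 0\<^sub>v (Suc r)"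
    and ev: "\<And>x. x \<le> r \<Longrightarrow> v $ x - (\<Sum>y\<le>r. P $$ (x, y) * v $ y) = \<theta> i * v $ x"
    unfolding L_eigenvalue_iff by auto
  let ?h = "\<lambda>x. \<bar>v $ x\<bar>"
  have "Max (?h ` {..r}) \<in> ?h ` {..r}" by (intro Max_in) auto
  then obtain a where "Max (?h ` {..r}) = ?h a" "a \<in> {..r}" by (rule imageE)
  then have a: "a \<le> r" and max_eq: "Max (?h ` {..r}) = \<bar>v $ a\<bar>" by simp_all
  have max: "\<bar>v $ y\<bar> \<le> \<bar>v $ a\<bar>" if "y \<le> r" for y
    unfolding max_eq[symmetric] using that by (intro Max_ge) auto
  have va: "0 < \<bar>v $ a\<bar>"
  proof (rule ccontr)
    assume "\<not> ?thesis"
    then have "v $ y = 0" if "y \<le> r" for y using max[OF that] by simp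
    then have "v = 0\<^sub>v (Suc r)" using v(1) by (intro eq_vecI) auto
    then show False using v by simp
  qed
  have "\<bar>1 - \<theta> i\<bar> * \<bar>v $ a\<bar> = \<bar>\<Sum>y\<le>r. P $$ (a, y) * v $ y\<bar>"
    using ev[OF a] by (simp add: algebra_simps flip: abs_mult)
  also have "\<dots> \<le> (\<Sum>y\<le>r. \<bar>P $$ (a, y) * v $ y\<bar>)" by (rule sum_abs)
  also have "\<dots> \<le> (\<Sum>y\<le>r. P $$ (a, y) * \<bar>v $ a\<bar>)"
    using nonneg a max by (intro sum_mono) (auto simp: abs_mult intro!: mult_left_mono)
  also have "\<dots> = 1 * \<bar>v $ a\<bar>" by (simp add: row_sum[OF a] flip: sum_distrib_right)
  finally have "\<bar>1 - \<theta> i\<bar> \<le> 1" using va by (rule mult_right_le_imp_le)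
  then show "0 < \<theta> i" "\<theta> i \<le> 2" using nz by (auto simp: abs_le_iff)
qed

abbreviation N :: "real poly mat" where "N \<equiv> char_poly_matrix L"

definition adjugate :: "nat \<Rightarrow> nat \<Rightarrow> real poly" where "adjugate x y = adj_mat N $$ (x, y)"

lemma N_carrier: "N \<in> carrier_mat (Suc r) (Suc r)"
  using L_carrier by simp

lemma N_index: "x \<le> r \<Longrightarrow> y \<le> r \<Longrightarrow>
    N $$ (x, y) = [:P $$ (x, y) - (if x = y then 1 else 0), if x = y then 1 else 0:]"
  using carrier by (auto simp: char_poly_matrix_def)

lemma N_adjugate: "x \<le> r \<Longrightarrow> y \<le> r \<Longrightarrow>
    (\<Sum>z\<le>r. N $$ (x, z) * adjugate z y) = (if x = y then [:0, 1:] * \<psi> else 0)"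
proof -
  assume xy: "x \<le> r" "y \<le> r"
  have "(N * adj_mat N) $$ (x, y) = (det N \<cdot>\<^sub>m 1\<^sub>m (Suc r)) $$ (x, y)"
    by (simp only: adj_mat(2)[OF N_carrier])
  then show ?thesis
    using xy N_carrier adj_mat(1)[OF N_carrier] char_poly_L
    by (auto simp: scalar_prod_def atLeast0LessThan lessThan_Suc_atMost adjugate_def char_poly_def)
qed

lemma adjugate_N: "x \<le> r \<Longrightarrow> y \<le> r \<Longrightarrow>
    (\<Sum>z\<le>r. adjugate x z * N $$ (z, y)) = (if x = y then [:0, 1:] * \<psi> else 0)"
proof -
  assume xy: "x \<le> r" "y \<le> r"
  have "(adj_mat N * N) $$ (x, y) = (det N \<cdot>\<^sub>m 1\<^sub>m (Suc r)) $$ (x, y)"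
    by (simp only: adj_mat(3)[OF N_carrier])
  then show ?thesis
    using xy N_carrier adj_mat(1)[OF N_carrier] char_poly_L
    by (auto simp: scalar_prod_def atLeast0LessThan lessThan_Suc_atMost adjugate_def char_poly_def)
qed

lemma N_stat: "z \<le> r \<Longrightarrow> (\<Sum>x\<le>r. [:\<pi> $ x:] * N $$ (x, z)) = [:0, 1:] * [:\<pi> $ z:]"
proof -
  assume z: "z \<le> r"
  have "(\<Sum>x\<le>r. [:\<pi> $ x:] * N $$ (x, z))
      = (\<Sum>x\<le>r. [:\<pi> $ x * P $$ (x, z):] + (if x = z then [:- \<pi> $ x, \<pi> $ x:] else 0))"
    using z by (intro sum.cong) (auto simp: N_index algebra_simps)
  also have "\<dots> = [:\<Sum>x\<le>r. \<pi> $ x * P $$ (x, z):] + [:- \<pi> $ z, \<pi> $ z:]"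
    using z by (simp add: sum.distrib const_poly_sum)
  finally show ?thesis using z by (simp add: stat_invariant)
qed

text \<open>
  \<open>\<pi>\<close> is a left eigenvector of the characteristic matrix for the eigenvalue \<open>x\<close>, hence one of the
  adjugate, for the determinant \<open>x \<psi>(x)\<close> divided by \<open>x\<close>.
\<close>
lemma stat_adjugate: "y \<le> r \<Longrightarrow> (\<Sum>x\<le>r. [:\<pi> $ x:] * adjugate x y) = \<psi> * [:\<pi> $ y:]"
proof -
  assume y: "y \<le> r"
  have "[:0, 1:] * (\<Sum>z\<le>r. [:\<pi> $ z:] * adjugate z y)
      = (\<Sum>z\<le>r. (\<Sum>x\<le>r. [:\<pi> $ x:] * N $$ (x, z)) * adjugate z y)"
    unfolding sum_distrib_left by (intro sum.cong) (simp_all only: N_stat atMost_iff mult.assoc)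
  also have "\<dots> = (\<Sum>x\<le>r. [:\<pi> $ x:] * (\<Sum>z\<le>r. N $$ (x, z) * adjugate z y))"
    unfolding sum_distrib_left sum_distrib_right mult.assoc by (rule sum.swap)
  also have "\<dots> = (\<Sum>x\<le>r. if x = y then [:\<pi> $ x:] * ([:0, 1:] * \<psi>) else 0)"
    using y by (intro sum.cong refl) (auto simp only: N_adjugate atMost_iff mult_zero_right split: if_splits)
  also have "\<dots> = [:0, 1:] * (\<psi> * [:\<pi> $ y:])" using y by (simp add: mult_ac)
  finally show ?thesis by (simp only: mult_cancel_left) auto
qed

text \<open>
  Deleting the last row and the first column leaves a lower triangular matrix with the upward
  probabilities \<open>p(i, i + 1)\<close> on the diagonal, because larger jumps upwards do not occur. The
  indeterminate disappears, as it stands on the diagonal of the full matrix.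
\<close>
lemma adjugate_corner: "adjugate 0 r = [:(- 1) ^ r * (\<Prod>i<r. P $$ (i, Suc i)):]"
proof -
  let ?M = "mat_delete N r 0"
  have M: "?M \<in> carrier_mat r r" using N_carrier by (auto simp: mat_delete_def)
  have idx: "?M $$ (i, j) = N $$ (i, Suc j)" if "i < r" "j < r" for i j
    using that N_carrier by (simp add: mat_delete_def)
  have "det ?M = prod_list (diag_mat ?M)"
  proof (rule det_lower_triangular[OF _ M])
    fix i j assume "i < j" "j < r"
    then show "?M $$ (i, j) = 0" by (simp add: idx N_index skip_free)
  qed
  also have "\<dots> = (\<Prod>i<r. ?M $$ (i, i))"
    using carrier_matD[OF M] by (simp add: diag_mat_def prod.list_conv_set_nth atLeast0LessThan)
  also have "\<dots> = (\<Prod>i<r. [:P $$ (i, Suc i):])"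
    by (intro prod.cong) (auto simp: idx N_index)
  also have "\<dots> = [:\<Prod>i<r. P $$ (i, Suc i):]" by (induction r) (simp_all add: one_pCons mult.commute)
  finally have "adjugate 0 r = (- 1) ^ r * [:\<Prod>i<r. P $$ (i, Suc i):]"
    using N_carrier by (simp add: adjugate_def adj_mat_def cofactor_def)
  also have "(- 1 :: real poly) ^ r = [:(- 1) ^ r:]" by (induction r) (simp_all add: one_pCons)
  finally show ?thesis by simp
qed

text \<open>
  The columns of the constant coefficient are annihilated by \<open>I - P\<close>, so they are constant; pairing
  them with \<open>\<pi>\<close> identifies the constants.
\<close>
lemma adjugate_coeff_0: "x \<le> r \<Longrightarrow> y \<le> r \<Longrightarrow> coeff (adjugate x y) 0 = coeff \<psi> 0 * \<pi> $ y"
proof -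
  assume x: "x \<le> r" and y: "y \<le> r"
  let ?h = "\<lambda>x. coeff (adjugate x y) 0"
  have harm: "(\<Sum>z\<le>r. P $$ (x, z) * ?h z) = ?h x" if x: "x \<le> r" for x
  proof -
    have "0 = coeff (\<Sum>z\<le>r. N $$ (x, z) * adjugate z y) 0"
      unfolding N_adjugate[OF x y] by simp
    also have "\<dots> = (\<Sum>z\<le>r. P $$ (x, z) * ?h z - (if x = z then ?h z else 0))"
      unfolding coeff_sum using x by (intro sum.cong) (auto simp: N_index coeff_mult algebra_simps)
    also have "\<dots> = (\<Sum>z\<le>r. P $$ (x, z) * ?h z) - ?h x"
      using x by (simp add: sum_subtractf)
    finally show ?thesis by simp
  qed
  have "coeff \<psi> 0 * \<pi> $ y = coeff (\<Sum>z\<le>r. [:\<pi> $ z:] * adjugate z y) 0"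
    unfolding stat_adjugate[OF y] by simp
  also have "\<dots> = (\<Sum>z\<le>r. \<pi> $ z * ?h z)" by (simp add: coeff_sum)
  also have "\<dots> = (\<Sum>z\<le>r. \<pi> $ z * ?h x)"
    using harmonic_const[OF harm _ x] by (intro sum.cong) auto
  also have "\<dots> = ?h x" by (simp add: stat_sum flip: sum_distrib_right)
  finally show ?thesis by simp
qed

text \<open>
  Comparing linear coefficients in \<open>(x - (I - P)) adj = x \<psi>(x)\<close>: up to the factor \<open>- \<psi>(0)\<close>, the
  linear coefficient of the adjugate inverts \<open>I - P\<close> modulo the projection onto the constants.
\<close>
lemma adjugate_coeff_1: "x \<le> r \<Longrightarrow> y \<le> r \<Longrightarrow>
    coeff (adjugate x y) 1 - (\<Sum>z\<le>r. P $$ (x, z) * coeff (adjugate z y) 1)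
      = coeff \<psi> 0 * (\<pi> $ y - (if x = y then 1 else 0))"
proof -
  assume x: "x \<le> r" and y: "y \<le> r"
  have "coeff (N $$ (x, z) * adjugate z y) 1
      = P $$ (x, z) * coeff (adjugate z y) 1 - (if x = z then coeff (adjugate z y) 1 - coeff (adjugate z y) 0 else 0)"
    if "z \<le> r" for z using x that by (auto simp: N_index algebra_simps)
  then have "coeff (\<Sum>z\<le>r. N $$ (x, z) * adjugate z y) 1
      = (\<Sum>z\<le>r. P $$ (x, z) * coeff (adjugate z y) 1) - (coeff (adjugate x y) 1 - coeff (adjugate x y) 0)"
    using x by (simp add: coeff_sum sum_subtractf)
  moreover have "coeff (\<Sum>z\<le>r. N $$ (x, z) * adjugate z y) 1 = (if x = y then coeff \<psi> 0 else 0)"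
    unfolding N_adjugate[OF x y] by simp
  ultimately show ?thesis using adjugate_coeff_0[OF x y] by (simp add: algebra_simps split: if_splits)
qed

lemma stat_adjugate_coeff_1: "y \<le> r \<Longrightarrow> (\<Sum>x\<le>r. \<pi> $ x * coeff (adjugate x y) 1) = coeff \<psi> 1 * \<pi> $ y"
  using arg_cong[OF stat_adjugate[of y], of "\<lambda>p. coeff p 1"] by (simp add: coeff_sum)

text \<open>
  The trace of the adjugate of the characteristic matrix is the derivative of the characteristic
  polynomial \<open>x \<psi>(x)\<close>, where the linear coefficient of \<open>\<psi>\<close> is that of \<open>x\<^sup>2\<close>.
\<close>
lemma trace_adjugate: "(\<Sum>x\<le>r. coeff (adjugate x x) 1) = 2 * coeff \<psi> 1"
proof -
  have "adjugate x x = char_poly (mat_delete L x x)" if "x \<le> r" for x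
  proof -
    have "mat_delete N x x = char_poly_matrix (mat_delete L x x)"
      using that carrier by (intro eq_matI) (auto simp: mat_delete_def char_poly_matrix_def)
    then show ?thesis
      using that N_carrier by (simp add: adjugate_def adj_mat_def cofactor_def char_poly_def)
  qed
  then have "(\<Sum>x\<le>r. adjugate x x) = pderiv (char_poly L)"
    by (simp add: pderiv_char_poly[OF L_carrier] lessThan_Suc_atMost)
  also have "\<dots> = \<psi> + [:0, 1:] * pderiv \<psi>"
    unfolding char_poly_L by (simp add: pderiv_mult pderiv_pCons)
  finally have "coeff (\<Sum>x\<le>r. adjugate x x) 1 = coeff (\<psi> + [:0, 1:] * pderiv \<psi>) 1" by simp
  then show ?thesis by (simp add: coeff_sum coeff_pderiv)
qed

lemma psi_0: "coeff \<psi> 0 = (- 1) ^ r * (\<Prod>i\<in>{1..r}. \<theta> i)"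
proof -
  have "coeff \<psi> 0 = (\<Prod>i\<in>{1..r}. - 1 * \<theta> i)"
    unfolding \<psi>_def poly_0_coeff_0[symmetric] poly_prod by (intro prod.cong) auto
  then show ?thesis by (simp only: prod.distrib prod_constant) simp
qed

lemma psi_0_nonzero: "coeff \<psi> 0 \<noteq> 0"
proof -
  have "\<theta> i \<noteq> 0" if "i \<in> {1..r}" for i using theta_bounds(1)[OF that] by simp
  then show ?thesis by (simp add: psi_0)
qed

text \<open>
  On the centred functions the resolvent is given by a matrix \<open>Z\<close> built from the linear coefficient
  of the adjugate. In any orthonormal basis of the centred functions its trace is the full trace
  of \<open>Z\<close>, which is \<open>2 \<Sum>\<^sub>i 1 / \<theta>\<^sub>i\<close>, minus the contribution \<open>\<Sum>\<^sub>i 1 / \<theta>\<^sub>i\<close> of the constants.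
\<close>
lemma Tr_R_eq: "Tr_R r P = (\<Sum>i\<in>{1..r}. 1 / \<theta> i)"
proof -
  let ?V = "l2_centred \<pi>"
  define B where "B = (SOME B. orthonormal_basis \<pi> ?V B)"
  have B: "orthonormal_basis \<pi> ?V B"
    unfolding B_def using ex_orthonormal_basis[OF stat_carrier stat_pos] by (rule someI_ex)
  define Z where "Z x y = - coeff (adjugate x y) 1 / coeff \<psi> 0" for x y
  have Z_stat: "(\<Sum>x\<le>r. \<pi> $ x * Z x y) = (\<Sum>i\<in>{1..r}. 1 / \<theta> i) * \<pi> $ y" if "y \<le> r" for y
  proof -
    have "(\<Sum>x\<le>r. \<pi> $ x * Z x y) = - (\<Sum>x\<le>r. \<pi> $ x * coeff (adjugate x y) 1) / coeff \<psi> 0"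
      by (simp add: Z_def sum_divide_distrib sum_negf)
    also have "\<dots> = - coeff \<psi> 1 / coeff \<psi> 0 * \<pi> $ y" by (simp only: stat_adjugate_coeff_1[OF that]) simp
    also have "coeff \<psi> 1 = - (\<Sum>i\<in>{1..r}. 1 / \<theta> i) * coeff \<psi> 0"
      unfolding \<psi>_def using theta_bounds(1) by (intro prod_linear_factors_coeffs) force+
    finally show ?thesis using psi_0_nonzero by simp
  qed
  have Z_trace: "(\<Sum>x\<le>r. Z x x) = 2 * (\<Sum>i\<in>{1..r}. 1 / \<theta> i)"
  proof -
    have "(\<Sum>x\<le>r. Z x x) = - 2 * coeff \<psi> 1 / coeff \<psi> 0"
      using trace_adjugate by (simp add: Z_def sum_negf flip: sum_divide_distrib)
    also have "coeff \<psi> 1 = - (\<Sum>i\<in>{1..r}. 1 / \<theta> i) * coeff \<psi> 0"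
      unfolding \<psi>_def using theta_bounds(1) by (intro prod_linear_factors_coeffs) force+
    finally show ?thesis using psi_0_nonzero by simp
  qed
  have L_Z: "Z x y - (\<Sum>z\<le>r. P $$ (x, z) * Z z y) = (if x = y then 1 else 0) - \<pi> $ y"
    if "x \<le> r" "y \<le> r" for x y
  proof -
    have "Z x y - (\<Sum>z\<le>r. P $$ (x, z) * Z z y)
        = - (coeff (adjugate x y) 1 - (\<Sum>z\<le>r. P $$ (x, z) * coeff (adjugate z y) 1)) / coeff \<psi> 0"
      by (simp add: Z_def sum_negf diff_divide_distrib sum_divide_distrib)
    also have "\<dots> = - (coeff \<psi> 0 * (\<pi> $ y - (if x = y then 1 else 0))) / coeff \<psi> 0"
      by (simp only: adjugate_coeff_1[OF that])
    finally show ?thesis using psi_0_nonzero by simp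
  qed
  have inj: "inj_on (\<lambda>f. L *\<^sub>v f) ?V"
  proof (rule inj_onI)
    fix f g assume f: "f \<in> ?V" and g: "g \<in> ?V" and eq: "L *\<^sub>v f = L *\<^sub>v g"
    have fc: "f \<in> carrier_vec (Suc r)" "(\<Sum>x\<le>r. f $ x * \<pi> $ x) = 0"
      and gc: "g \<in> carrier_vec (Suc r)" "(\<Sum>x\<le>r. g $ x * \<pi> $ x) = 0"
      using f g by (auto simp: l2_centred_iff[OF stat_carrier])
    define h where "h x = f $ x - g $ x" for x
    have harm: "(\<Sum>y\<le>r. P $$ (x, y) * h y) = h x" if x: "x \<le> r" for x
      using arg_cong[OF eq, of "\<lambda>v. v $ x"]
      unfolding one_minus_mult_vec_index[OF carrier fc(1) x] one_minus_mult_vec_index[OF carrier gc(1) x]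
      by (simp add: h_def right_diff_distrib sum_subtractf)
    have "h x = 0" if x: "x \<le> r" for x
    proof -
      have "h x = (\<Sum>y\<le>r. h x * \<pi> $ y)" by (simp add: stat_sum flip: sum_distrib_left)
      also have "\<dots> = (\<Sum>y\<le>r. h y * \<pi> $ y)"
        using harmonic_const[OF harm x] by (intro sum.cong) auto
      also have "\<dots> = 0" using fc gc by (simp add: h_def left_diff_distrib sum_subtractf)
      finally show ?thesis .
    qed
    then show "f = g" using fc gc by (intro eq_vecI) (auto simp: h_def)
  qed
  have R: "resolvent_op r P e = vec (Suc r) (\<lambda>x. \<Sum>y\<le>r. Z x y * e $ y)" (is "_ = ?Ze") if e: "e \<in> ?V" for e
    unfolding resolvent_op_def
  proof (rule inv_into_f_eq[OF inj])
    have ec: "e \<in> carrier_vec (Suc r)" "(\<Sum>x\<le>r. e $ x * \<pi> $ x) = 0"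
      using e by (auto simp: l2_centred_iff[OF stat_carrier])
    have "(\<Sum>x\<le>r. ?Ze $ x * \<pi> $ x) = (\<Sum>x\<le>r. \<Sum>y\<le>r. (\<pi> $ x * Z x y) * e $ y)"
      by (simp add: sum_distrib_left mult_ac)
    also have "\<dots> = (\<Sum>y\<le>r. (\<Sum>x\<le>r. \<pi> $ x * Z x y) * e $ y)"
      by (subst sum.swap) (simp add: sum_distrib_right)
    also have "\<dots> = (\<Sum>y\<le>r. (\<Sum>i\<in>{1..r}. 1 / \<theta> i) * (e $ y * \<pi> $ y))"
      by (intro sum.cong) (simp_all add: Z_stat)
    also have "\<dots> = 0" using ec by (simp flip: sum_distrib_left)
    finally show "?Ze \<in> ?V" by (simp add: l2_centred_iff[OF stat_carrier])
    show "L *\<^sub>v ?Ze = e"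
    proof (rule eq_vecI)
      fix x assume "x < dim_vec e"
      then have x: "x \<le> r" using ec by auto
      have "(L *\<^sub>v ?Ze) $ x = ?Ze $ x - (\<Sum>z\<le>r. P $$ (x, z) * ?Ze $ z)"
        by (rule one_minus_mult_vec_index[OF carrier _ x]) simp
      also have "\<dots> = (\<Sum>y\<le>r. Z x y * e $ y) - (\<Sum>z\<le>r. \<Sum>y\<le>r. P $$ (x, z) * Z z y * e $ y)"
        using x by (simp add: sum_distrib_left mult.assoc)
      also have "(\<Sum>z\<le>r. \<Sum>y\<le>r. P $$ (x, z) * Z z y * e $ y)
          = (\<Sum>y\<le>r. (\<Sum>z\<le>r. P $$ (x, z) * Z z y) * e $ y)"
        by (subst sum.swap) (simp add: sum_distrib_right)
      also have "(\<Sum>y\<le>r. Z x y * e $ y) - \<dots> = (\<Sum>y\<le>r. (Z x y - (\<Sum>z\<le>r. P $$ (x, z) * Z z y)) * e $ y)"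
        by (simp add: left_diff_distrib sum_subtractf)
      also have "\<dots> = (\<Sum>y\<le>r. (if x = y then e $ y else 0) - e $ y * \<pi> $ y)"
      proof (intro sum.cong refl)
        fix y assume "y \<in> {..r}"
        then have "y \<le> r" by simp
        then show "(Z x y - (\<Sum>z\<le>r. P $$ (x, z) * Z z y)) * e $ y
            = (if x = y then e $ y else 0) - e $ y * \<pi> $ y"
          unfolding L_Z[OF x \<open>y \<le> r\<close>] by (simp add: left_diff_distrib)
      qed
      also have "\<dots> = e $ x - (\<Sum>y\<le>r. e $ y * \<pi> $ y)"
        using x by (simp add: sum_subtractf)
      also have "\<dots> = e $ x" by (simp only: ec(2) diff_zero)
      finally show "(L *\<^sub>v ?Ze) $ x = e $ x" .
    qed (use ec L_carrier in auto)
  qed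
  have BV: "e \<in> ?V" if "e \<in> B" for e using B that by (auto simp: orthonormal_basis_def)
  have "Tr_R r P = (\<Sum>e\<in>B. \<Sum>x\<le>r. \<Sum>y\<le>r. Z x y * (e $ y * e $ x * \<pi> $ x))"
    unfolding Tr_R_def op_trace_def B_def[symmetric]
    by (intro sum.cong refl)
      (simp add: R BV l2_inner_eq[OF stat_carrier] sum_distrib_right sum_distrib_left mult_ac)
  also have "\<dots> = (\<Sum>x\<le>r. \<Sum>y\<le>r. Z x y * (\<Sum>e\<in>B. e $ y * e $ x * \<pi> $ x))"
    unfolding sum_distrib_left
    by (subst sum.swap, intro sum.cong refl sum.swap)
  also have "\<dots> = (\<Sum>x\<le>r. \<Sum>y\<le>r. (if y = x then Z x y else 0) - \<pi> $ x * Z x y)"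
  proof (intro sum.cong refl)
    fix x y assume "x \<in> {..r}" "y \<in> {..r}"
    then have "x \<le> r" "y \<le> r" by simp_all
    show "Z x y * (\<Sum>e\<in>B. e $ y * e $ x * \<pi> $ x) = (if y = x then Z x y else 0) - \<pi> $ x * Z x y"
      unfolding orthonormal_basis_resolution[OF stat_carrier stat_sum B \<open>y \<le> r\<close> \<open>x \<le> r\<close>]
      by (simp add: right_diff_distrib)
  qed
  also have "\<dots> = (\<Sum>x\<le>r. Z x x) - (\<Sum>x\<le>r. \<Sum>y\<le>r. \<pi> $ x * Z x y)"
    by (simp add: sum_subtractf)
  also have "(\<Sum>x\<le>r. \<Sum>y\<le>r. \<pi> $ x * Z x y) = (\<Sum>y\<le>r. \<Sum>x\<le>r. \<pi> $ x * Z x y)"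
    by (rule sum.swap)
  also have "(\<Sum>y\<le>r. \<Sum>x\<le>r. \<pi> $ x * Z x y) = (\<Sum>y\<le>r. (\<Sum>i\<in>{1..r}. 1 / \<theta> i) * \<pi> $ y)"
    by (intro sum.cong) (simp_all add: Z_stat)
  also have "\<dots> = (\<Sum>i\<in>{1..r}. 1 / \<theta> i)" by (simp add: stat_sum flip: sum_distrib_left)
  finally show ?thesis using Z_trace by simp
qed

text \<open>
  The vector \<open>h(y) = \<Sum>\<^sub>k P\<^sup>k(y, r) z\<^sup>k\<close>, with \<open>z = 1 / (1 + u)\<close>, solves \<open>(I - z P) h = \<delta>\<^sub>r\<close>, so \<open>h(0)\<close> is a corner entry of the
  adjugate divided by the determinant. The entry is a constant polynomial and therefore equal to
  its constant coefficient \<open>\<psi>(0) \<pi>(r)\<close>, which normalises the product.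
\<close>
lemma corner_generating_function:
  assumes u: "0 < u"
  shows "(\<lambda>k. (P ^\<^sub>m k) $$ (0, r) * (1 / (1 + u)) ^ k)
    sums (\<pi> $ r * ((1 + u) / u) * (\<Prod>i\<in>{1..r}. \<theta> i / (\<theta> i + u)))"
proof -
  let ?z = "1 / (1 + u)"
  define h where "h x = (\<Sum>k. (P ^\<^sub>m k) $$ (x, r) * ?z ^ k)" for x
  have sm: "summable (\<lambda>k. (P ^\<^sub>m k) $$ (x, r) * ?z ^ k)" if x: "x \<le> r" for x
  proof (rule summable_comparison_test_ev)
    show "summable (\<lambda>k. ?z ^ k)" using u by (intro summable_geometric) simp
    have "norm ((P ^\<^sub>m k) $$ (x, r) * ?z ^ k) \<le> ?z ^ k" for k
      using pow_nonneg[OF x, of r k] pow_le_1[OF x, of r k] u by (simp add: abs_mult mult_left_le_one_le)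
    then show "eventually (\<lambda>k. norm ((P ^\<^sub>m k) $$ (x, r) * ?z ^ k) \<le> ?z ^ k) sequentially" by simp
  qed
  have step: "h x = (if x = r then 1 else 0) + ?z * (\<Sum>y\<le>r. P $$ (x, y) * h y)" if x: "x \<le> r" for x
  proof -
    have "h x = (P ^\<^sub>m 0) $$ (x, r) * ?z ^ 0 + (\<Sum>k. (P ^\<^sub>m Suc k) $$ (x, r) * ?z ^ Suc k)"
      unfolding h_def by (subst suminf_split_head[OF sm[OF x]]) simp
    also have "(\<lambda>k. (P ^\<^sub>m Suc k) $$ (x, r) * ?z ^ Suc k)
        = (\<lambda>k. ?z * (\<Sum>y\<le>r. P $$ (x, y) * ((P ^\<^sub>m k) $$ (y, r) * ?z ^ k)))"
      using x by (intro ext) (simp add: pow_Suc_left sum_distrib_left sum_distrib_right mult_ac del: pow_mat.simps)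
    also have "suminf \<dots> = ?z * (\<Sum>y\<le>r. P $$ (x, y) * h y)"
    proof (rule sums_unique[symmetric])
      show "(\<lambda>k. ?z * (\<Sum>y\<le>r. P $$ (x, y) * ((P ^\<^sub>m k) $$ (y, r) * ?z ^ k)))
          sums (?z * (\<Sum>y\<le>r. P $$ (x, y) * h y))"
        unfolding h_def by (intro sums_mult sums_sum summable_sums sm) auto
    qed
    finally show ?thesis using x by (simp add: pow_0 del: pow_mat.simps)
  qed
  have Nh: "(\<Sum>y\<le>r. poly (N $$ (x, y)) (- u) * h y) = (if x = r then - (1 + u) else 0)" if x: "x \<le> r" for x
  proof -
    have "(1 + u) * h x = (1 + u) * (if x = r then 1 else 0) + (1 + u) * ?z * (\<Sum>y\<le>r. P $$ (x, y) * h y)"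
      by (subst step[OF x]) (simp only: distrib_left mult.assoc)
    also have "(1 + u) * ?z = 1" using u by simp
    finally have hx: "(1 + u) * h x = (1 + u) * (if x = r then 1 else 0) + (\<Sum>y\<le>r. P $$ (x, y) * h y)"
      by simp
    have "(\<Sum>y\<le>r. poly (N $$ (x, y)) (- u) * h y)
        = (\<Sum>y\<le>r. P $$ (x, y) * h y - (if x = y then (1 + u) * h y else 0))"
      using x by (intro sum.cong) (auto simp: N_index algebra_simps)
    also have "\<dots> = (\<Sum>y\<le>r. P $$ (x, y) * h y) - (1 + u) * h x"
      using x by (simp add: sum_subtractf)
    finally show ?thesis using hx by (simp split: if_splits)
  qed
  have "poly ([:0, 1:] * \<psi>) (- u) * h 0
      = (\<Sum>y\<le>r. poly (\<Sum>x\<le>r. adjugate 0 x * N $$ (x, y)) (- u) * h y)"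
  proof -
    have "(\<Sum>y\<le>r. poly (\<Sum>x\<le>r. adjugate 0 x * N $$ (x, y)) (- u) * h y)
        = (\<Sum>y\<le>r. if 0 = y then poly ([:0, 1:] * \<psi>) (- u) * h y else 0)"
      by (intro sum.cong refl) (auto simp: adjugate_N)
    then show ?thesis by simp
  qed
  also have "\<dots> = (\<Sum>x\<le>r. poly (adjugate 0 x) (- u) * (\<Sum>y\<le>r. poly (N $$ (x, y)) (- u) * h y))"
    unfolding poly_sum poly_mult sum_distrib_left sum_distrib_right mult.assoc by (rule sum.swap)
  also have "\<dots> = (\<Sum>x\<le>r. if x = r then - (1 + u) * poly (adjugate 0 x) (- u) else 0)"
    by (intro sum.cong refl) (auto simp: Nh)
  also have "\<dots> = - (1 + u) * coeff (adjugate 0 r) 0"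
    by (simp add: adjugate_corner)
  also have "\<dots> = - (1 + u) * (coeff \<psi> 0 * \<pi> $ r)" by (simp add: adjugate_coeff_0)
  finally have "u * poly \<psi> (- u) * h 0 = (1 + u) * (coeff \<psi> 0 * \<pi> $ r)"
    by (simp add: algebra_simps)
  moreover have "poly \<psi> (- u) = (- 1) ^ r * (\<Prod>i\<in>{1..r}. \<theta> i + u)"
  proof -
    have "poly \<psi> (- u) = (\<Prod>i\<in>{1..r}. - 1 * (\<theta> i + u))"
      unfolding \<psi>_def poly_prod by (intro prod.cong) auto
    then show ?thesis by (simp only: prod.distrib prod_constant) simp
  qed
  ultimately have "(- 1) ^ r * (u * (\<Prod>i\<in>{1..r}. \<theta> i + u) * h 0)
      = (- 1) ^ r * ((1 + u) * (\<Prod>i\<in>{1..r}. \<theta> i) * \<pi> $ r)"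
    by (simp add: psi_0 mult_ac)
  then have "u * (\<Prod>i\<in>{1..r}. \<theta> i + u) * h 0 = (1 + u) * (\<Prod>i\<in>{1..r}. \<theta> i) * \<pi> $ r"
    by simp
  moreover have "0 < (\<Prod>i\<in>{1..r}. \<theta> i + u)"
    using theta_bounds(1) u by (intro prod_pos) (auto intro: add_pos_pos)
  moreover have "h' = p * ((1 + u) / u) * (T / K)"
    if "u * K * h' = (1 + u) * T * p" "0 < K" for h' p T K :: real
    using that u by (simp add: divide_simps) (simp add: algebra_simps)
  ultimately have "h 0 = \<pi> $ r * ((1 + u) / u) * (\<Prod>i\<in>{1..r}. \<theta> i / (\<theta> i + u))"
    unfolding prod_dividef by blast
  then show ?thesis using summable_sums[OF sm[of 0]] by (simp add: h_def)
qed

end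

section \<open>The separation cutoff\<close>

text \<open>
  The case \<open>r = 0\<close> is excluded: there the chain starts in its only state, and \<open>F 0\<close> below would
  be \<open>1\<close>.
\<close>
locale monotone_chain = spectral_chain +
  assumes monotone: "stochastically_monotone r (time_reversal r P)"
    and r_pos: "1 \<le> r"
begin

definition F :: "nat \<Rightarrow> real" where "F k = (P ^\<^sub>m k) $$ (0, r) / \<pi> $ r"

text \<open>
  The jumps of \<open>F\<close>; at \<open>k = 0\<close> truncated subtraction gives the value \<open>0\<close>, which is right
  because \<open>F 0 = 0\<close>.
\<close>
definition f :: "nat \<Rightarrow> real" where "f k = F k - F (k - 1)"

lemma F_0: "F 0 = 0"
  using r_pos pow_0[of 0 r] by (simp add: F_def del: pow_mat.simps)

lemma sum_f: "(\<Sum>j\<le>k. f j) = F k"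
  by (induction k) (simp_all add: f_def F_0)

lemma sep_eq: "sep r P k 0 = 1 - F k"
  unfolding F_def by (rule sep_monotone(1)[OF monotone])

lemma f_nonneg: "0 \<le> f k"
  using sep_monotone(2)[OF monotone, of "k - 1"] by (cases k) (auto simp: f_def F_def)

lemma f_pgf: "0 < u \<Longrightarrow>
  (\<lambda>k. f k * (1 / (1 + u)) ^ k) sums (\<Prod>i\<in>{1..r}. \<theta> i / (\<theta> i + u))"
proof -
  assume u: "0 < u"
  let ?z = "1 / (1 + u)" and ?H = "\<Prod>i\<in>{1..r}. \<theta> i / (\<theta> i + u)"
  let ?S = "(1 + u) / u * ?H"
  have pr: "\<pi> $ r \<noteq> 0" using stat_pos[of r] by simp
  have "(\<lambda>k. F k * ?z ^ k) sums (\<pi> $ r * ((1 + u) / u) * ?H / \<pi> $ r)"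
    unfolding F_def using sums_divide[OF corner_generating_function[OF u], of "\<pi> $ r"] by simp
  then have S: "(\<lambda>k. F k * ?z ^ k) sums ?S" using pr by simp
  have "(\<lambda>k. F (Suc k - 1) * ?z ^ Suc k) sums (?z * ?S)"
    using sums_mult[OF S, of ?z] by (simp add: mult_ac)
  from sums_Suc[OF this] have "(\<lambda>k. F (k - 1) * ?z ^ k) sums (?z * ?S)" by (simp add: F_0)
  from sums_diff[OF S this] have "(\<lambda>k. f k * ?z ^ k) sums (?S - ?z * ?S)"
    by (simp only: f_def left_diff_distrib)
  also have "?z * ?S = ?H / u" using u by simp
  also have "?S - ?H / u = ?H" using u by (simp add: diff_divide_distrib[symmetric] algebra_simps)
  finally show ?thesis .
qed

sublocale pgf: rational_pgf f "{1..r}" \<theta>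
  by unfold_locales (use theta_bounds(1) f_nonneg f_pgf in \<open>auto simp: f_def\<close>)

lemma sep_time_eq: "sep_time r P 0 \<epsilon> = pgf.quantile \<epsilon>"
  by (simp add: sep_time_def pgf.quantile_def pgf.tail_def sum_f sep_eq)

lemma Tr_R_eq_mean: "Tr_R r P = pgf.mean"
  by (simp only: Tr_R_eq pgf.mean_def)

lemma rho_eq: "rho r \<theta> = sqrt pgf.var"
  by (simp only: rho_def pgf.var_def)

end

lemma monotone_chainI:
  assumes "P \<in> class_SM r" "nonzero_eigenvalues r P \<theta>" "1 \<le> r"
  shows "monotone_chain r P \<theta>"
  using assms
  by unfold_locales (auto simp: class_SM_def class_S_def skip_free_def)

theorem theorem8p1:
  fixes r :: "nat \<Rightarrow> nat" and P :: "nat \<Rightarrow> real mat" and \<theta> :: "nat \<Rightarrow> nat \<Rightarrow> real"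
    and \<epsilon> :: real
  assumes size: "\<And>n. 1 \<le> n \<Longrightarrow> 1 \<le> r n"
    and chain: "\<And>n. 1 \<le> n \<Longrightarrow> P n \<in> class_SM (r n)"
    and erg: "\<And>n. 1 \<le> n \<Longrightarrow> ergodic (r n) (P n)"
    and eig: "\<And>n. 1 \<le> n \<Longrightarrow> nonzero_eigenvalues (r n) (P n) (\<theta> n)"
    and eps: "0 < \<epsilon>" "\<epsilon> < 1"
  shows
    "(separation_cutoff r P \<and> filterlim (\<lambda>n. Tr_R (r n) (P n)) at_top sequentially \<longleftrightarrow>
        filterlim (\<lambda>n. Tr_R (r n) (P n) * theta_min (r n) (\<theta> n)) at_top sequentially) \<and>
     (filterlim (\<lambda>n. Tr_R (r n) (P n) * theta_min (r n) (\<theta> n)) at_top sequentially \<longleftrightarrow>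
        filterlim (\<lambda>n. real (sep_time (r n) (P n) 0 \<epsilon>) * theta_min (r n) (\<theta> n))
          at_top sequentially) \<and>
     (filterlim (\<lambda>n. Tr_R (r n) (P n) * theta_min (r n) (\<theta> n)) at_top sequentially \<longrightarrow>
        separation_cutoff_window r P (\<lambda>n. Tr_R (r n) (P n))
          (\<lambda>n. max (rho (r n) (\<theta> n)) 1))"
proof -
  have mc: "monotone_chain (r n) (P n) (\<theta> n)" if "1 \<le> n" for n
    using monotone_chainI chain eig size that by blast
  interpret fam: rational_pgf_family "\<lambda>n. monotone_chain.f (r n) (P n)" "\<lambda>n. {1..r n}" \<theta>
  \<comment> \<open>The introduction rule is applied by hand, as \<open>unfold_locales\<close> would also unfold the
    predicate \<open>rational_pgf\<close>.\<close>
  proof (rule rational_pgf_family.intro)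
    fix n :: nat assume n: "1 \<le> n"
    interpret monotone_chain "r n" "P n" "\<theta> n" by (rule mc[OF n])
    show "rational_pgf f {1..r n} (\<theta> n)" by (rule pgf.rational_pgf_axioms)
    show "{1..r n} \<noteq> {}" using size[OF n] by simp
    show "\<theta> n i \<le> 2" if "i \<in> {1..r n}" for i by (rule theta_bounds(2)[OF that])
  qed
  have T: "Tr_R (r n) (P n) = fam.m n" and q: "sep_time (r n) (P n) 0 \<epsilon> = fam.q n \<epsilon>"
    and rh: "rho (r n) (\<theta> n) = sqrt (fam.v n)" if n: "1 \<le> n" for n \<epsilon>
  proof -
    interpret monotone_chain "r n" "P n" "\<theta> n" by (rule mc[OF n])
    show "Tr_R (r n) (P n) = fam.m n" "sep_time (r n) (P n) 0 \<epsilon> = fam.q n \<epsilon>"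
      "rho (r n) (\<theta> n) = sqrt (fam.v n)"
      by (simp_all only: Tr_R_eq_mean fam.m_def sep_time_eq fam.q_def rho_eq fam.v_def)
  qed
  have g: "theta_min (r n) (\<theta> n) = fam.gap n" for n by (simp only: theta_min_def fam.gap_def)
  have cong: "filterlim x G sequentially \<longleftrightarrow> filterlim y G sequentially"
    if "\<And>n. 1 \<le> n \<Longrightarrow> x n = y n" for x y :: "nat \<Rightarrow> real" and G
  proof (rule filterlim_cong[OF refl refl])
    show "eventually (\<lambda>n. x n = y n) sequentially"
      using eventually_ge_at_top[of 1] by eventually_elim (rule that)
  qed
  have trace_iff: "filterlim (\<lambda>n. Tr_R (r n) (P n)) at_top sequentially \<longleftrightarrow> filterlim fam.m at_top sequentially"
    by (rule cong) (rule T)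
  have trace_gap_iff: "filterlim (\<lambda>n. Tr_R (r n) (P n) * theta_min (r n) (\<theta> n)) at_top sequentially
      \<longleftrightarrow> filterlim (\<lambda>n. fam.m n * fam.gap n) at_top sequentially"
    by (rule cong) (simp only: T g)
  have time_gap_iff: "filterlim (\<lambda>n. real (sep_time (r n) (P n) 0 \<epsilon>) * theta_min (r n) (\<theta> n)) at_top sequentially
      \<longleftrightarrow> filterlim (\<lambda>n. real (fam.q n \<epsilon>) * fam.gap n) at_top sequentially"
    by (rule cong) (simp only: q g)
  have cutoff_iff: "separation_cutoff r P \<longleftrightarrow> (\<exists>t. (\<forall>n\<ge>1. 0 < t n) \<and>
      (\<forall>\<epsilon>. 0 < \<epsilon> \<and> \<epsilon> < 1 \<longrightarrow> (\<lambda>n. real (fam.q n \<epsilon>) / t n) \<longlonglongrightarrow> 1))"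
  proof -
    have "(\<lambda>n. real (sep_time (r n) (P n) 0 \<epsilon>) / t n) \<longlonglongrightarrow> 1
        \<longleftrightarrow> (\<lambda>n. real (fam.q n \<epsilon>) / t n) \<longlonglongrightarrow> 1" for \<epsilon> t
      by (rule cong) (simp only: q)
    then show ?thesis unfolding separation_cutoff_def by simp
  qed
  have window: "separation_cutoff_window r P (\<lambda>n. Tr_R (r n) (P n)) (\<lambda>n. max (rho (r n) (\<theta> n)) 1)"
    if top: "filterlim (\<lambda>n. fam.m n * fam.gap n) at_top sequentially"
    unfolding separation_cutoff_window_def
  proof (intro conjI allI impI)
    fix n :: nat assume "1 \<le> n"
    then show "0 < Tr_R (r n) (P n)" using fam.m_pos by (simp only: T)
    show "0 < max (rho (r n) (\<theta> n)) 1" by (simp add: less_max_iff_disj)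
  next
    have "(\<lambda>n. max (rho (r n) (\<theta> n)) 1 / Tr_R (r n) (P n)) \<longlonglongrightarrow> 0
        \<longleftrightarrow> (\<lambda>n. fam.b n / fam.m n) \<longlonglongrightarrow> 0"
      by (rule cong) (simp only: T rh)
    then show "(\<lambda>n. max (rho (r n) (\<theta> n)) 1 / Tr_R (r n) (P n)) \<longlonglongrightarrow> 0"
      using fam.window_ratio[OF top] by simp
  next
    fix \<epsilon> :: real assume e: "0 < \<epsilon> \<and> \<epsilon> < 1"
    let ?C = "1 / sqrt \<epsilon> + 2 / sqrt (1 - \<epsilon>)"
    have "limsup (\<lambda>n. ereal (\<bar>real (sep_time (r n) (P n) 0 \<epsilon>) - Tr_R (r n) (P n)\<bar>
        / max (rho (r n) (\<theta> n)) 1)) \<le> ereal ?C"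
    proof (rule Limsup_bounded)
      show "eventually (\<lambda>n. ereal (\<bar>real (sep_time (r n) (P n) 0 \<epsilon>) - Tr_R (r n) (P n)\<bar>
          / max (rho (r n) (\<theta> n)) 1) \<le> ereal ?C) sequentially"
        using eventually_ge_at_top[of 1]
        by eventually_elim (use fam.quantile_window e in \<open>simp only: T q rh ereal_less_eq\<close>)
    qed
    also have "\<dots> < \<infinity>" by simp
    finally show "limsup (\<lambda>n. ereal (\<bar>real (sep_time (r n) (P n) 0 \<epsilon>) - Tr_R (r n) (P n)\<bar>
        / max (rho (r n) (\<theta> n)) 1)) < \<infinity>" .
  qed
  have "separation_cutoff r P \<and> filterlim fam.m at_top sequentially
      \<longleftrightarrow> filterlim (\<lambda>n. fam.m n * fam.gap n) at_top sequentially" (is "?L \<longleftrightarrow> ?R")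
  proof
    assume ?L
    then obtain t where "\<forall>n\<ge>1. 0 < t n"
      "\<forall>\<epsilon>. 0 < \<epsilon> \<and> \<epsilon> < 1 \<longrightarrow> (\<lambda>n. real (fam.q n \<epsilon>) / t n) \<longlonglongrightarrow> 1"
      and "filterlim fam.m at_top sequentially"
      unfolding cutoff_iff by blast
    then show ?R by (intro fam.cutoff_imp_gap[of t]) auto
  next
    assume ?R
    then show ?L
      unfolding cutoff_iff using fam.m_at_top fam.m_pos fam.quantile_ratio by blast
  qed
  then show ?thesis
    using window fam.mean_iff_quantile[OF eps] unfolding trace_iff trace_gap_iff time_gap_iff by blast
qed

end
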